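(* Let $R=\Bbbk[S]$ be a semi-standard graded affine semigroup ring with $S\subseteq\mathbb{N}^d$. Let $I$ be a non-principal $\mathbb{N}^d$-graded ideal of $R$, and let $b=\min\{i : I_i\neq 0\}$, where $I_i=I\cap R_i$. If $\operatorname{depth} R\geq 2$ and $$(\mathbf{x}^{\mathbf{e}} : \mathbf{e}\in E_S)R\subseteq \operatorname{tr}(I),$$ then $\dim_{\Bbbk} I_b\geq 2$.
   Context: $\Bbbk$ is a field and $\mathbb{N}$ includes $0$. An affine semigroup $S$ is a finitely generated sub-semigroup (containing $0$) of $\mathbb{Z}^d$; here $S\subseteq\mathbb{N}^d$. $R=\Bbbk[S]$ has $\Bbbk$-basis the monomials $\mathbf{x}^{\mathbf{a}}$, $\mathbf{a}\in S$, and is naturally $\mathbb{N}^d$-graded; an $\mathbb{N}^d$-graded ideal is one generated by monomials. "Semi-standard graded" means: $R=\bigoplus_{i\in\mathbb{N}}R_i$ is an $\mathbb{N}$-graded Noetherian $\Bbbk$-algebra with $R_0=\Bbbk$ that is finitely generated as a module over $\Bbbk[R_1]$; for affine semigroup rings the $\mathbb{N}$-grading is one for which every monomial $\mathbf{x}^{\mathbf{a}}$ is homogeneous. $R$ is not assumed Cohen--Macaulay. $G_S$ denotes the unique minimal generating set of $S$. A face $F\subseteq S$ is a subset such that for all $a,b\in S$: $a+b\in F$ if and only if $a\in F$ and $b\in F$; its dimension is the rank of the group $\mathbb{Z}F$. $E_S=\{\mathbf{a}\in G_S : \mathbb{N}\mathbf{a}\text{ is a 1-dimensional face of }S\}$.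 For a graded $R$-module $M$, the trace is $\operatorname{tr}(M)=\sum_{\phi}\phi(M)$, the sum over all graded $R$-homomorphisms $\phi:M\to R$ (of arbitrary degree). *)

theory Defs
  imports
    "HOL-Algebra.Algebra"
    "HOL-Library.Poly_Mapping"
    "HOL-Library.Extended_Nat"
    "HOL-Analysis.Finite_Cartesian_Product"
begin

section \<open>Affine semigroups\<close>

inductive_set submonoid_gen :: "'a::comm_monoid_add set \<Rightarrow> 'a set" for G where
  zero: "0 \<in> submonoid_gen G"
| add: "\<lbrakk>a \<in> G; x \<in> submonoid_gen G\<rbrakk> \<Longrightarrow> a + x \<in> submonoid_gen G"

definition affine_semigroup :: "(nat^'d) set \<Rightarrow> bool" where
  "affine_semigroup S \<longleftrightarrow> (\<exists>G. finite G \<and> S = submonoid_gen G)"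

definition is_min_gens :: "(nat^'d) set \<Rightarrow> (nat^'d) set \<Rightarrow> bool" where
  "is_min_gens S G \<longleftrightarrow> submonoid_gen G = S \<and> (\<forall>H. H \<subset> G \<longrightarrow> submonoid_gen H \<noteq> S)"

definition min_gens :: "(nat^'d) set \<Rightarrow> (nat^'d) set" where
  "min_gens S = (THE G. is_min_gens S G)"

definition is_face :: "(nat^'d) set \<Rightarrow> (nat^'d) set \<Rightarrow> bool" where
  "is_face S F \<longleftrightarrow> F \<subseteq> S \<and> (\<forall>a\<in>S. \<forall>b\<in>S. a + b \<in> F \<longleftrightarrow> a \<in> F \<and> b \<in> F)"

definition int_vec :: "nat^'d \<Rightarrow> int^'d" where
  "int_vec a = (\<chi> i. int (a $ i))"

text \<open>The integer span of the image of \<open>F\<close> in \<open>\<int>\<^sup>d\<close> is the group \<open>\<int>F\<close>.\<close>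

definition group_gen :: "(nat^'d) set \<Rightarrow> (int^'d) set" where
  "group_gen F = module.span ((*s) :: int \<Rightarrow> int^'d \<Rightarrow> int^'d) (int_vec ` F)"

text \<open>The rank of an abelian group is the maximal number of \<open>\<int>\<close>-linearly independent elements.\<close>

definition group_rank :: "(int^'d) set \<Rightarrow> enat" where
  "group_rank H = Sup {enat (card B) | B. finite B \<and> B \<subseteq> H \<and>
     \<not> module.dependent ((*s) :: int \<Rightarrow> int^'d \<Rightarrow> int^'d) B}"

definition face_dim :: "(nat^'d) set \<Rightarrow> enat" where
  "face_dim F = group_rank (group_gen F)"

definition extremal_gens :: "(nat^'d) set \<Rightarrow> (nat^'d) set" where
  "extremal_gens S = {a \<in> min_gens S.
     is_face S (range (\<lambda>n::nat. n *s a)) \<and> face_dim (range (\<lambda>n::nat. n *s a)) = 1}"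


section \<open>Affine semigroup rings\<close>

text \<open>
  The type \<open>nat^'d \<Rightarrow>\<^sub>0 'k\<close> with convolution product is the polynomial ring over \<open>'k\<close> in
  variables indexed by \<open>'d\<close>; the semigroup ring is its subring of elements supported in \<open>S\<close>.
\<close>

definition semigroup_ring :: "(nat^'d) set \<Rightarrow> (nat^'d \<Rightarrow>\<^sub>0 'k::field) ring" where
  "semigroup_ring S =
     \<lparr>carrier = {p. Poly_Mapping.keys p \<subseteq> S}, monoid.mult = (*), one = 1, ring.zero = 0, ring.add = (+)\<rparr>"

definition scalars :: "(nat^'d \<Rightarrow>\<^sub>0 'k::field) set" where
  "scalars = range (Poly_Mapping.single 0)"

definition xpow :: "nat^'d \<Rightarrow> (nat^'d \<Rightarrow>\<^sub>0 'k::field)" where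
  "xpow a = Poly_Mapping.single a 1"

definition monomial_ideal :: "(nat^'d) set \<Rightarrow> (nat^'d \<Rightarrow>\<^sub>0 'k::field) set \<Rightarrow> bool" where
  "monomial_ideal S I \<longleftrightarrow> (\<exists>A\<subseteq>S. I = Idl\<^bsub>semigroup_ring S\<^esub> (xpow ` A))"


section \<open>Graded rings\<close>

definition nat_grading :: "('a, 'b) ring_scheme \<Rightarrow> (nat \<Rightarrow> 'a set) \<Rightarrow> bool" where
  "nat_grading R Rg \<longleftrightarrow>
     (\<forall>i. additive_subgroup (Rg i) R) \<and>
     (\<forall>i j. \<forall>x\<in>Rg i. \<forall>y\<in>Rg j. x \<otimes>\<^bsub>R\<^esub> y \<in> Rg (i + j)) \<and>
     (\<forall>x\<in>carrier R. \<exists>!f. (\<forall>i. f i \<in> Rg i) \<and> finite {i. f i \<noteq> \<zero>\<^bsub>R\<^esub>} \<and>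
        x = (\<Oplus>\<^bsub>R\<^esub>i\<in>{i. f i \<noteq> \<zero>\<^bsub>R\<^esub>}. f i))"

definition fin_gen_over :: "('a, 'b) ring_scheme \<Rightarrow> 'a set \<Rightarrow> bool" where
  "fin_gen_over R A \<longleftrightarrow>
     (\<exists>B\<subseteq>carrier R. finite B \<and> (\<forall>x\<in>carrier R. \<exists>c\<in>B \<rightarrow> A. x = (\<Oplus>\<^bsub>R\<^esub>b\<in>B. c b \<otimes>\<^bsub>R\<^esub> b)))"

text \<open>\<open>K\<close> is the coefficient field, embedded in \<open>R\<close>.\<close>

definition semistandard_graded ::
    "('a, 'b) ring_scheme \<Rightarrow> 'a set \<Rightarrow> (nat \<Rightarrow> 'a set) \<Rightarrow> bool" where
  "semistandard_graded R K Rg \<longleftrightarrow>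
     cring R \<and> noetherian_ring R \<and> subfield K R \<and> nat_grading R Rg \<and> Rg 0 = K \<and>
     fin_gen_over R (generate_ring R (K \<union> Rg 1))"

definition irrelevant_ideal :: "('a, 'b) ring_scheme \<Rightarrow> (nat \<Rightarrow> 'a set) \<Rightarrow> 'a set" where
  "irrelevant_ideal R Rg = Idl\<^bsub>R\<^esub> (\<Union>i\<in>{1..}. Rg i)"

definition regular_sequence :: "('a, 'b) ring_scheme \<Rightarrow> 'a list \<Rightarrow> bool" where
  "regular_sequence R xs \<longleftrightarrow>
     set xs \<subseteq> carrier R \<and>
     (\<forall>i<length xs. \<forall>r\<in>carrier R.
        (xs ! i) \<otimes>\<^bsub>R\<^esub> r \<in> Idl\<^bsub>R\<^esub> (set (take i xs)) \<longrightarrow> r \<in> Idl\<^bsub>R\<^esub> (set (take i xs))) \<and>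
     Idl\<^bsub>R\<^esub> (set xs) \<noteq> carrier R"

text \<open>
  Depth of a graded ring with \<open>R\<^sub>0\<close> a field: supremum of the lengths of the regular sequences
  in the homogeneous maximal ideal; its members need not be homogeneous.
\<close>

definition graded_depth :: "('a, 'b) ring_scheme \<Rightarrow> (nat \<Rightarrow> 'a set) \<Rightarrow> enat" where
  "graded_depth R Rg =
     Sup {enat (length xs) | xs. set xs \<subseteq> irrelevant_ideal R Rg \<and> regular_sequence R xs}"


section \<open>The trace of a graded module\<close>

definition int_graded :: "('a, 'b) ring_scheme \<Rightarrow> (nat \<Rightarrow> 'a set) \<Rightarrow> int \<Rightarrow> 'a set" where
  "int_graded R Rg n = (if n \<ge> 0 then Rg (nat n) else {\<zero>\<^bsub>R\<^esub>})"

definition graded_homs ::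
    "('a, 'b) ring_scheme \<Rightarrow> (nat \<Rightarrow> 'a set) \<Rightarrow> ('a, 'm, 'c) module_scheme \<Rightarrow> (int \<Rightarrow> 'm set)
      \<Rightarrow> ('m \<Rightarrow> 'a) set" where
  "graded_homs R Rg M Mg = {\<phi> \<in> carrier M \<rightarrow> carrier R.
     (\<forall>x\<in>carrier M. \<forall>y\<in>carrier M. \<phi> (x \<oplus>\<^bsub>M\<^esub> y) = \<phi> x \<oplus>\<^bsub>R\<^esub> \<phi> y) \<and>
     (\<forall>r\<in>carrier R. \<forall>x\<in>carrier M. \<phi> (r \<odot>\<^bsub>M\<^esub> x) = r \<otimes>\<^bsub>R\<^esub> \<phi> x) \<and>
     (\<exists>j. \<forall>i. \<forall>x\<in>Mg i. \<phi> x \<in> int_graded R Rg (i + j))}"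

text \<open>The sum of the family of ideals \<open>\<phi>(M)\<close>: all finite sums of elements of these ideals.\<close>

definition module_trace ::
    "('a, 'b) ring_scheme \<Rightarrow> (nat \<Rightarrow> 'a set) \<Rightarrow> ('a, 'm, 'c) module_scheme \<Rightarrow> (int \<Rightarrow> 'm set)
      \<Rightarrow> 'a set" where
  "module_trace R Rg M Mg = {\<Oplus>\<^bsub>R\<^esub>\<phi>\<in>\<Phi>. y \<phi> | \<Phi> y.
     finite \<Phi> \<and> \<Phi> \<subseteq> graded_homs R Rg M Mg \<and> (\<forall>\<phi>\<in>\<Phi>. y \<phi> \<in> \<phi> ` carrier M)}"

definition ideal_module :: "('a, 'b) ring_scheme \<Rightarrow> 'a set \<Rightarrow> ('a, 'a) module" where
  "ideal_module R I =
     \<lparr>carrier = I, monoid.mult = monoid.mult R, one = one R, ring.zero = ring.zero R, ring.add = ring.add R, smult = monoid.mult R\<rparr>"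

definition trace_ideal :: "('a, 'b) ring_scheme \<Rightarrow> (nat \<Rightarrow> 'a set) \<Rightarrow> 'a set \<Rightarrow> 'a set" where
  "trace_ideal R Rg I = module_trace R Rg (ideal_module R I) (\<lambda>i. I \<inter> int_graded R Rg i)"

end

theory Submission
  imports Defs
begin

text \<open>
  Let \<open>T\<close> be the set of exponents of the monomials in \<open>I\<close>, and suppose that \<open>I\<^sub>b\<close> contains only
  one monomial, with exponent \<open>m\<close>. The proof shows that every \<open>t \<in> T\<close> lies in \<open>m + S\<close>, so that
  \<open>I\<close> is generated by \<open>x\<^sup>m\<close>, which was excluded.

  The trace hypothesis is used through a commutation trick. If \<open>x\<^sup>e\<close> occurs in \<open>\<phi>(x\<^sup>a)\<close> for a linear
  map \<open>\<phi> : I \<rightarrow> R\<close> and a monomial \<open>x\<^sup>a \<in> I\<close>, then comparing \<open>x\<^sup>t \<phi>(x\<^sup>a) = x\<^sup>a \<phi>(x\<^sup>t)\<close> in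
  exponent \<open>t + e\<close> gives \<open>t + e \<in> a + S\<close> for every \<open>t \<in> T\<close> (\<open>monomial_in_trace\<close>). When \<open>e\<close> has
  degree \<open>1\<close>, taking \<open>t = m\<close> leaves two possibilities by degree: \<open>a = m + e\<close>, which already gives
  \<open>T \<subseteq> m + S\<close>, or \<open>a = m\<close>. In both cases \<open>t + e \<in> m + S\<close> (\<open>trace_forces_divisibility\<close>).

  Semistandardness supplies enough extremal generators of degree \<open>1\<close>. Every element of \<open>S\<close> has a
  positive multiple that is a sum of elements of degree \<open>1\<close> (\<open>multiple_in_degree_1_submonoid\<close>,
  an integrality argument carried out on exponents). A minimal set \<open>W\<close> of elements of degree \<open>1\<close>
  with this property consists of extremal generators (\<open>minimal_cone_generators_face\<close>), and all
  elements of \<open>S\<close> of large degree lie in \<open>W + S\<close>. Hence \<open>x\<^sup>t\<close> is carried into \<open>x\<^sup>m R\<close> by a power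
  of the irrelevant ideal.

  Finally, depth at least two means that \<open>R/x\<^sup>m R\<close> has positive depth, so no nonzero class in it is
  killed by a power of the irrelevant ideal. Concretely, for a regular sequence \<open>u, v\<close> one writes
  \<open>u\<^sup>D x\<^sup>t = x\<^sup>m p\<close> and \<open>v\<^sup>D x\<^sup>t = x\<^sup>m q\<close>; cancelling \<open>x\<^sup>m\<close> in the cross product gives
  \<open>v\<^sup>D p = u\<^sup>D q\<close>, so \<open>u\<^sup>D\<close> divides \<open>p\<close> and \<open>x\<^sup>m\<close> divides \<open>x\<^sup>t\<close>
  (\<open>depth_two_principal_monomial_saturated\<close>).
\<close>

section \<open>Generated submonoids\<close>

lemma submonoid_gen_incl: "a \<in> G \<Longrightarrow> a \<in> submonoid_gen G"
  using submonoid_gen.add[OF _ submonoid_gen.zero, of a G] by simp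

lemma submonoid_gen_add_closed:
  assumes "x \<in> submonoid_gen G" "y \<in> submonoid_gen G"
  shows "x + y \<in> submonoid_gen G"
  using assms by (induction rule: submonoid_gen.induct) (auto simp: add.assoc intro: submonoid_gen.add)

lemma submonoid_gen_least:
  assumes "0 \<in> T" "\<And>x y. x \<in> T \<Longrightarrow> y \<in> T \<Longrightarrow> x + y \<in> T" "G \<subseteq> T"
  shows "submonoid_gen G \<subseteq> T"
proof
  fix x assume "x \<in> submonoid_gen G"
  then show "x \<in> T" by induction (use assms in auto)
qed

lemma Suc_smult_vec: "Suc n *s (x::nat^'d) = x + n *s x"
  by (simp add: vec_eq_iff)

lemma smult_submonoid_gen:
  fixes x :: "nat^'d"
  assumes "x \<in> submonoid_gen G"
  shows "n *s x \<in> submonoid_gen G"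
  by (induction n) (use assms in \<open>auto simp: Suc_smult_vec submonoid_gen.zero intro: submonoid_gen_add_closed\<close>)

lemma sum_submonoid_gen:
  assumes "\<And>i. i \<in> J \<Longrightarrow> f i \<in> submonoid_gen G"
  shows "sum f J \<in> submonoid_gen G"
  using assms
  by (induction J rule: infinite_finite_induct) (auto intro: submonoid_gen_add_closed submonoid_gen.zero)

lemma submonoid_gen_finite_repr:
  fixes x :: "nat^'d"
  assumes "x \<in> submonoid_gen G" "finite G"
  obtains c where "x = (\<Sum>g\<in>G. c g *s g)"
proof -
  have "\<exists>c. x = (\<Sum>g\<in>G. c g *s g)"
    using assms(1)
  proof induction
    case zero
    show ?case by (intro exI[of _ "\<lambda>_. 0"]) simp
  next
    case (add a x)
    then obtain c where c: "x = (\<Sum>g\<in>G. c g *s g)" by blast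
    have "(\<Sum>g\<in>G. (c(a := Suc (c a))) g *s g) = (Suc (c a) *s a) + (\<Sum>g\<in>G - {a}. c g *s g)"
      using add(1) assms(2) by (subst sum.remove[of _ a]) auto
    also have "\<dots> = a + x"
      using add(1) assms(2) unfolding c Suc_smult_vec by (subst (2) sum.remove[of _ a]) (auto simp: add.assoc)
    finally show ?case by metis
  qed
  with that show ?thesis by blast
qed

section \<open>Positively graded affine semigroups\<close>

locale graded_affine_semigroup =
  fixes S :: "(nat^'d) set" and deg :: "nat^'d \<Rightarrow> nat"
  assumes affine: "affine_semigroup S"
    and deg_add: "\<And>a b. a \<in> S \<Longrightarrow> b \<in> S \<Longrightarrow> deg (a + b) = deg a + deg b"
    and deg_pos: "\<And>a. a \<in> S \<Longrightarrow> a \<noteq> 0 \<Longrightarrow> deg a > 0"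
begin

lemma zero_mem: "0 \<in> S"
  using affine unfolding affine_semigroup_def by (auto intro: submonoid_gen.zero)

lemma add_mem: "a \<in> S \<Longrightarrow> b \<in> S \<Longrightarrow> a + b \<in> S"
  using affine unfolding affine_semigroup_def by (auto intro: submonoid_gen_add_closed)

lemma submonoid_gen_subset: "G \<subseteq> S \<Longrightarrow> submonoid_gen G \<subseteq> S"
  by (intro submonoid_gen_least zero_mem add_mem)

lemma smult_mem: "a \<in> S \<Longrightarrow> n *s a \<in> S"
  using smult_submonoid_gen[of a S n] submonoid_gen_incl[of a S] submonoid_gen_subset[of S] by auto

lemma sum_mem: "(\<And>i. i \<in> J \<Longrightarrow> f i \<in> S) \<Longrightarrow> sum f J \<in> S"
  by (induction J rule: infinite_finite_induct) (auto intro: add_mem zero_mem)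

lemma deg_0: "deg 0 = 0"
  using deg_add[OF zero_mem zero_mem] by simp

lemma deg_eq_0_iff: "a \<in> S \<Longrightarrow> deg a = 0 \<longleftrightarrow> a = 0"
  using deg_pos deg_0 by force

lemma deg_smult: "a \<in> S \<Longrightarrow> deg (n *s a) = n * deg a"
  by (induction n) (auto simp: deg_0 Suc_smult_vec deg_add smult_mem)

lemma deg_sum: "(\<And>i. i \<in> J \<Longrightarrow> f i \<in> S) \<Longrightarrow> deg (sum f J) = (\<Sum>i\<in>J. deg (f i))"
  by (induction J rule: infinite_finite_induct) (auto simp: deg_0 deg_add sum_mem)

lemma deg_combination:
  "W \<subseteq> S \<Longrightarrow> deg (\<Sum>w\<in>W. c w *s w) = (\<Sum>w\<in>W. c w * deg w)"
  by (subst deg_sum) (auto simp: smult_mem deg_smult intro!: sum.cong)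

lemma finite_gens:
  obtains G where "finite G" "0 \<notin> G" "G \<subseteq> S" "S = submonoid_gen G"
proof -
  obtain G where G: "finite G" "S = submonoid_gen G"
    using affine unfolding affine_semigroup_def by blast
  have "submonoid_gen G \<subseteq> submonoid_gen (G - {0})"
  proof
    fix x assume "x \<in> submonoid_gen G"
    then show "x \<in> submonoid_gen (G - {0})"
    proof induction
      case (add a x)
      then show ?case by (cases "a = 0") (auto intro: submonoid_gen.add)
    qed (rule submonoid_gen.zero)
  qed
  moreover have "submonoid_gen (G - {0}) \<subseteq> S"
    using G(2) submonoid_gen_incl by (intro submonoid_gen_subset) auto
  ultimately show ?thesis
    using G submonoid_gen_incl[of _ G] by (intro that[of "G - {0}"]) auto
qed

text \<open>
  Nonzero generators have positive degree, so a bound on the degree bounds every coefficient of a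
  representation by generators.
\<close>

lemma finite_deg_le: "finite {a \<in> S. deg a \<le> i}"
proof -
  obtain G where G: "finite G" "0 \<notin> G" "G \<subseteq> S" "S = submonoid_gen G"
    by (rule finite_gens)
  have "{a \<in> S. deg a \<le> i} \<subseteq> (\<lambda>c. \<Sum>g\<in>G. c g *s g) ` (G \<rightarrow>\<^sub>E {..i})"
  proof
    fix a assume "a \<in> {a \<in> S. deg a \<le> i}"
    then have a: "a \<in> S" "deg a \<le> i" by auto
    obtain c where c: "a = (\<Sum>g\<in>G. c g *s g)"
      using submonoid_gen_finite_repr a(1) G by metis
    have "c g \<le> i" if g: "g \<in> G" for g
    proof -
      have "0 < deg g" using G g deg_pos by blast
      then have "c g \<le> c g * deg g" by simp
      also have "\<dots> \<le> (\<Sum>g\<in>G. c g * deg g)"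
        using G(1) g by (intro member_le_sum) auto
      also have "\<dots> = deg a" unfolding c using G(3) deg_combination by simp
      finally show ?thesis using a(2) by simp
    qed
    then have "restrict c G \<in> G \<rightarrow>\<^sub>E {..i}" by auto
    moreover have "a = (\<Sum>g\<in>G. restrict c G g *s g)" unfolding c by (intro sum.cong) auto
    ultimately show "a \<in> (\<lambda>c. \<Sum>g\<in>G. c g *s g) ` (G \<rightarrow>\<^sub>E {..i})" by blast
  qed
  then show ?thesis by (rule finite_subset) (use G(1) in \<open>auto intro: finite_PiE\<close>)
qed

subsection \<open>The minimal generators\<close>

definition irreducibles :: "(nat^'d) set" where
  "irreducibles = {s \<in> S. s \<noteq> 0 \<and> (\<forall>a\<in>S. \<forall>b\<in>S. s = a + b \<longrightarrow> a = 0 \<or> b = 0)}"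

lemma irreducibles_subset_gens:
  assumes "submonoid_gen G = S"
  shows "irreducibles \<subseteq> G"
proof
  fix s assume s: "s \<in> irreducibles"
  have "x \<in> G" if "x \<in> submonoid_gen G" "x \<in> irreducibles" for x
    using that
  proof induction
    case zero
    then show ?case by (simp add: irreducibles_def)
  next
    case (add a x)
    have "a \<in> S" "x \<in> S" using add(1,2) assms submonoid_gen_incl by auto
    with add have "a = 0 \<or> x = 0" by (auto simp: irreducibles_def)
    with add show ?case by auto
  qed
  then show "s \<in> G" using s assms by (auto simp: irreducibles_def)
qed

text \<open>Splitting an element into two nonzero summands lowers the degree, so the process terminates.\<close>

lemma submonoid_gen_irreducibles: "submonoid_gen irreducibles = S"
proof
  show "submonoid_gen irreducibles \<subseteq> S"
    by (intro submonoid_gen_subset) (auto simp: irreducibles_def)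
  show "S \<subseteq> submonoid_gen irreducibles"
  proof
    fix s assume "s \<in> S"
    then show "s \<in> submonoid_gen irreducibles"
    proof (induction "deg s" arbitrary: s rule: less_induct)
      case less
      show ?case
      proof (cases "s = 0 \<or> s \<in> irreducibles")
        case True
        then show ?thesis by (auto intro: submonoid_gen.zero submonoid_gen_incl)
      next
        case False
        then obtain a b where ab: "a \<in> S" "b \<in> S" "s = a + b" "a \<noteq> 0" "b \<noteq> 0"
          using less(2) by (auto simp: irreducibles_def)
        then have "deg a < deg s" "deg b < deg s"
          using deg_add[of a b] deg_pos[of a] deg_pos[of b] by auto
        with less ab show ?thesis by (auto intro: submonoid_gen_add_closed)
      qed
    qed
  qed
qed

lemma min_gens_eq_irreducibles: "min_gens S = irreducibles"
  unfolding min_gens_def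
proof (rule the_equality)
  show "is_min_gens S irreducibles"
    using irreducibles_subset_gens submonoid_gen_irreducibles unfolding is_min_gens_def by blast
next
  fix G assume "is_min_gens S G"
  then show "G = irreducibles"
    using irreducibles_subset_gens submonoid_gen_irreducibles unfolding is_min_gens_def by blast
qed

lemma deg_1_irreducible:
  assumes "s \<in> S" "deg s = 1"
  shows "s \<in> irreducibles"
  unfolding irreducibles_def
proof (intro CollectI conjI ballI impI)
  show "s \<noteq> 0" using assms deg_0 by auto
  fix a b assume ab: "a \<in> S" "b \<in> S" "s = a + b"
  then have "deg a + deg b = 1" using assms deg_add by simp
  then have "deg a = 0 \<or> deg b = 0" by linarith
  then show "a = 0 \<or> b = 0" using ab deg_eq_0_iff by blast
qed (rule assms)

end

subsection \<open>One-dimensional faces\<close>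

lemma module_int_vec: "Modules.module ((*s) :: int \<Rightarrow> int^'d \<Rightarrow> int^'d)"
  by unfold_locales (auto simp: vec_eq_iff algebra_simps)

text \<open>
  The group generated by the multiples of \<open>w\<close> is \<open>\<int>w\<close>. Any two distinct elements of it are
  dependent, while \<open>w\<close> alone is independent.
\<close>

lemma face_dim_multiples:
  fixes w :: "nat^'d"
  assumes "w \<noteq> 0"
  shows "face_dim (range (\<lambda>n::nat. n *s w)) = 1"
proof -
  interpret Z: Modules.module "(*s) :: int \<Rightarrow> int^'d \<Rightarrow> int^'d" by (rule module_int_vec)
  define v where "v = int_vec w"
  have v: "v \<noteq> 0" using assms by (auto simp: v_def int_vec_def vec_eq_iff)
  have smult_v_eq_0: "c *s v = 0 \<longleftrightarrow> c = 0" for c using v by simp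
  define H where "H = group_gen (range (\<lambda>n::nat. n *s w))"
  have "Z.subspace (range (\<lambda>c. c *s v))"
    unfolding Z.subspace_def
  proof (intro conjI ballI allI)
    show "0 \<in> range (\<lambda>c. c *s v)" by (rule image_eqI[of _ _ 0]) auto
    fix x y assume "x \<in> range (\<lambda>c. c *s v)" "y \<in> range (\<lambda>c. c *s v)"
    then show "x + y \<in> range (\<lambda>c. c *s v)" by (metis (no_types, lifting) Z.scale_left_distrib rangeE rangeI)
  next
    fix c x assume "x \<in> range (\<lambda>c. c *s v)"
    then show "c *s x \<in> range (\<lambda>c. c *s v)" by (metis (no_types, lifting) Z.scale_scale rangeE rangeI)
  qed
  moreover have "int_vec (n *s w) = int n *s v" for n
    by (simp add: v_def int_vec_def vec_eq_iff)
  then have "int_vec ` range (\<lambda>n::nat. n *s w) \<subseteq> range (\<lambda>c. c *s v)" by auto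
  ultimately have H: "H \<subseteq> range (\<lambda>c. c *s v)"
    unfolding H_def group_gen_def by (intro Z.span_minimal)
  have "w = 1 *s w" by (rule vector_smult_lid[symmetric])
  then have "v \<in> int_vec ` range (\<lambda>n::nat. n *s w)" unfolding v_def by (intro imageI) (rule range_eqI)
  then have vH: "v \<in> H"
    unfolding H_def group_gen_def by (rule Z.span_base)
  have card_le: "card B \<le> 1" if B: "finite B" "B \<subseteq> H" "\<not> Z.dependent B" for B
  proof (rule ccontr)
    assume "\<not> card B \<le> 1"
    then obtain x y where xy: "x \<in> B" "y \<in> B" "x \<noteq> y"
      using card_le_Suc0_iff_eq[OF B(1)] by auto
    obtain c d where cd: "x = c *s v" "y = d *s v" using xy B(2) H by blast
    \<comment> \<open>the relation \<open>d x - c y = 0\<close> with \<open>x = c v\<close> and \<open>y = d v\<close>\<close>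
    define u where "u = (\<lambda>z. if z = x then d else - c)"
    have "(\<Sum>z\<in>{x, y}. u z *s z) = 0"
      using xy(3) by (simp add: u_def cd vec_eq_iff)
    moreover have "\<exists>z\<in>{x, y}. u z \<noteq> 0"
    proof (rule ccontr)
      assume "\<not> ?thesis"
      then have "u x = 0" "u y = 0" by blast+
      then have "d = 0" "c = 0" using xy(3) by (simp_all add: u_def split: if_splits)
      then show False using xy(3) cd by simp
    qed
    ultimately have "Z.dependent B"
      unfolding Z.dependent_explicit using xy
      by (intro exI[of _ "{x, y}"] exI[of _ u]) auto
    with B(3) show False by blast
  qed
  have indep: "\<not> Z.dependent {v}"
  proof
    assume "Z.dependent {v}"
    then obtain t u where "t \<subseteq> {v}" "(\<Sum>z\<in>t. u z *s z) = 0" "\<exists>z\<in>t. u z \<noteq> 0"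
      unfolding Z.dependent_explicit by blast
    moreover from this have "t = {v}" by blast
    ultimately show False using smult_v_eq_0 by simp
  qed
  let ?C = "{enat (card B) | B. finite B \<and> B \<subseteq> H \<and> \<not> Z.dependent B}"
  have "Sup ?C = 1"
  proof (rule antisym)
    show "Sup ?C \<le> 1"
      by (rule Sup_least) (use card_le in \<open>auto simp: one_enat_def\<close>)
    have "enat (card {v}) \<in> ?C" using indep vH by blast
    then show "1 \<le> Sup ?C" by (intro Sup_upper) (simp add: one_enat_def)
  qed
  then show ?thesis unfolding face_dim_def group_rank_def H_def .
qed

context graded_affine_semigroup
begin

text \<open>
  Elements of \<open>S\<close> have multiples in \<open>\<nat>W\<close>, that is, \<open>W\<close> generates the rational cone of \<open>S\<close>. If \<open>a + b\<close>
  is a multiple of \<open>w \<in> W\<close>, then writing multiples of \<open>a\<close> and \<open>b\<close> in terms of \<open>W\<close> gives a relation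
  expressing a multiple of \<open>w\<close> by elements of \<open>W\<close>. If it is nontrivial, then solving it for \<open>w\<close> makes
  \<open>w\<close> redundant, contrary to minimality. Hence it is trivial, and \<open>a\<close> is proportional to \<open>w\<close>; it is
  an integral multiple because \<open>w\<close> has degree \<open>1\<close>. This replaces the theorem that a cone is generated
  by its extremal rays.
\<close>

lemma minimal_cone_generators_face:
  assumes W: "finite W" "W \<subseteq> {a \<in> S. deg a = 1}"
    and gen: "\<And>s. s \<in> S \<Longrightarrow> \<exists>n>0. n *s s \<in> submonoid_gen W"
    and min: "\<And>W'. W' \<subset> W \<Longrightarrow> \<exists>s\<in>S. \<forall>n>0. n *s s \<notin> submonoid_gen W'"
    and w: "w \<in> W"
  shows "is_face S (range (\<lambda>n::nat. n *s w))"
proof -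
  have WS: "W \<subseteq> S" and deg_W: "\<And>x. x \<in> W \<Longrightarrow> deg x = 1" using W(2) by auto
  \<comment> \<open>If a multiple of \<open>w\<close> is a combination of the others, substitution removes \<open>w\<close> from every
     representation, after scaling by \<open>M\<close>.\<close>
  have not_redundant: "M *s w \<notin> submonoid_gen (W - {w})" if M: "M > 0" for M
  proof
    assume red: "M *s w \<in> submonoid_gen (W - {w})"
    have "\<exists>n>0. n *s s \<in> submonoid_gen (W - {w})" if s: "s \<in> S" for s
    proof -
      obtain n where n: "n > 0" "n *s s \<in> submonoid_gen W" using gen s by blast
      then obtain c where c: "n *s s = (\<Sum>x\<in>W. c x *s x)"
        using submonoid_gen_finite_repr W(1) by metis
      have "(M * n) *s s = M *s (\<Sum>x\<in>W. c x *s x)"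
        unfolding c[symmetric] by (simp add: vector_smult_assoc)
      also have "\<dots> = M *s (c w *s w) + M *s (\<Sum>x\<in>W - {w}. c x *s x)"
        using w W(1) by (subst sum.remove[of _ w]) (auto simp: vector_add_ldistrib)
      also have "M *s (c w *s w) = c w *s (M *s w)"
        by (simp add: vector_smult_assoc mult.commute)
      also have "c w *s (M *s w) + M *s (\<Sum>x\<in>W - {w}. c x *s x) \<in> submonoid_gen (W - {w})"
        by (intro submonoid_gen_add_closed smult_submonoid_gen red sum_submonoid_gen submonoid_gen_incl)
      finally show ?thesis using n(1) M by (intro exI[of _ "M * n"]) auto
    qed
    moreover have "W - {w} \<subset> W" using w by blast
    ultimately show False using min by meson
  qed
  have summand: "a \<in> range (\<lambda>n::nat. n *s w)"
    if ab: "a \<in> S" "b \<in> S" "a + b = k *s w" for a b k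
  proof -
    obtain n where n: "n > 0" "n *s a \<in> submonoid_gen W" using gen ab by blast
    then obtain \<alpha> where \<alpha>: "n *s a = (\<Sum>x\<in>W. \<alpha> x *s x)"
      using submonoid_gen_finite_repr W(1) by metis
    obtain n' where n': "n' > 0" "n' *s b \<in> submonoid_gen W" using gen ab by blast
    then obtain \<beta> where \<beta>: "n' *s b = (\<Sum>x\<in>W. \<beta> x *s x)"
      using submonoid_gen_finite_repr W(1) by metis
    define \<gamma> where "\<gamma> x = n' * \<alpha> x + n * \<beta> x" for x
    define K where "K = n * n' * k"
    have "K *s w = n' *s (n *s a) + n *s (n' *s b)"
      using ab(3) by (simp add: K_def vec_eq_iff vector_smult_assoc) (metis distrib_left mult.assoc mult.commute)
    also have "\<dots> = (\<Sum>x\<in>W. \<gamma> x *s x)"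
      unfolding \<alpha> \<beta> \<gamma>_def
      by (simp add: vec_eq_iff sum_distrib_left algebra_simps sum.distrib)
    finally have Kw: "K *s w = (\<Sum>x\<in>W. \<gamma> x *s x)" .
    \<comment> \<open>Members of \<open>W\<close> have degree \<open>1\<close>, so the degree bounds the coefficient of \<open>w\<close> on the right by
       the one on the left; subtracting it stays within the natural numbers.\<close>
    have "deg (K *s w) = K" using deg_smult[of w] deg_W[OF w] w WS by auto
    moreover have "deg (\<Sum>x\<in>W. \<gamma> x *s x) = (\<Sum>x\<in>W. \<gamma> x)"
      using deg_combination[OF WS] deg_W by simp
    ultimately have K: "K = (\<Sum>x\<in>W. \<gamma> x)" using Kw by simp
    then have \<gamma>_le: "\<gamma> w \<le> K" using w W(1) by (auto intro: member_le_sum)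
    have "K *s w = \<gamma> w *s w + (\<Sum>x\<in>W - {w}. \<gamma> x *s x)"
      unfolding Kw using w W(1) by (subst sum.remove[of _ w]) auto
    moreover have "K *s w = \<gamma> w *s w + (K - \<gamma> w) *s w"
      using \<gamma>_le by (simp flip: vector_sadd_rdistrib)
    ultimately have "(K - \<gamma> w) *s w = (\<Sum>x\<in>W - {w}. \<gamma> x *s x)" by simp
    then have "(K - \<gamma> w) *s w \<in> submonoid_gen (W - {w})"
      by (simp only:) (intro sum_submonoid_gen smult_submonoid_gen submonoid_gen_incl)
    then have "K - \<gamma> w = 0" using not_redundant by blast
    then have "\<gamma> w = K" using \<gamma>_le by simp
    moreover have "K = \<gamma> w + (\<Sum>x\<in>W - {w}. \<gamma> x)" unfolding K using w W(1) by (subst sum.remove[of _ w]) auto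
    ultimately have "\<gamma> x = 0" if "x \<in> W - {w}" for x using that W(1) by simp
    then have "\<alpha> x = 0" if "x \<in> W - {w}" for x using that n'(1) unfolding \<gamma>_def by fastforce
    then have na: "n *s a = \<alpha> w *s w"
      unfolding \<alpha> using w W(1) by (subst sum.remove[of _ w]) auto
    have deg_na: "n * deg a = \<alpha> w"
      using arg_cong[OF na, of deg] deg_smult[of w] deg_smult[of a] deg_W[OF w] w WS ab(1) by auto
    have "n * a $ i = n * (deg a * w $ i)" for i
      using arg_cong[OF na, of "\<lambda>v. v $ i"] by (simp flip: deg_na mult.assoc)
    then have "a = deg a *s w" using n(1) by (simp add: vec_eq_iff)
    then show ?thesis by blast
  qed
  show ?thesis
    unfolding is_face_def
  proof (intro conjI ballI iffI)
    show "range (\<lambda>n::nat. n *s w) \<subseteq> S" using smult_mem w WS by blast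
    fix a b assume ab: "a \<in> S" "b \<in> S"
    {
      assume *: "a + b \<in> range (\<lambda>n::nat. n *s w)"
      then show "a \<in> range (\<lambda>n::nat. n *s w)" using summand ab by blast
      from * show "b \<in> range (\<lambda>n::nat. n *s w)" using summand[of b a] ab by (auto simp: add.commute)
    }
    {
      assume "a \<in> range (\<lambda>n::nat. n *s w) \<and> b \<in> range (\<lambda>n::nat. n *s w)"
      then show "a + b \<in> range (\<lambda>n::nat. n *s w)" by (metis (no_types, lifting) rangeE rangeI vector_sadd_rdistrib)
    }
  qed
qed

text \<open>
  The set of all elements of degree \<open>1\<close> is finite and generates the rational cone of \<open>S\<close>, so among its
  subsets that still generate the cone there is one of least cardinality.
\<close>

lemma extremal_cone_generators:
  assumes "\<And>s. s \<in> S \<Longrightarrow> \<exists>n>0. n *s s \<in> submonoid_gen {a \<in> S. deg a = 1}"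
  obtains W where "W \<subseteq> extremal_gens S" "W \<subseteq> {a \<in> S. deg a = 1}"
    "\<And>s. s \<in> S \<Longrightarrow> \<exists>n>0. n *s s \<in> submonoid_gen W"
proof -
  define V where "V = {a \<in> S. deg a = 1}"
  have "finite V" unfolding V_def by (rule finite_subset[OF _ finite_deg_le[of 1]]) auto
  let ?P = "\<lambda>W. W \<subseteq> V \<and> (\<forall>s\<in>S. \<exists>n>0. n *s s \<in> submonoid_gen W)"
  have "?P V" using assms by (auto simp: V_def)
  then obtain W where W: "?P W" and least: "\<And>W'. ?P W' \<Longrightarrow> card W \<le> card W'"
    using ex_has_least_nat[of ?P V card] by blast
  have fin: "finite W" using W \<open>finite V\<close> finite_subset by blast
  have min: "\<exists>s\<in>S. \<forall>n>0. n *s s \<notin> submonoid_gen W'" if "W' \<subset> W" for W'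
    using least[of W'] psubset_card_mono[OF fin that] that W by force
  have "w \<in> extremal_gens S" if w: "w \<in> W" for w
  proof -
    have wS: "w \<in> S" "deg w = 1" using w W by (auto simp: V_def)
    then have "w \<noteq> 0" using deg_0 by auto
    moreover have "is_face S (range (\<lambda>n::nat. n *s w))"
      using minimal_cone_generators_face[OF fin _ _ min w] W by (auto simp: V_def)
    ultimately show ?thesis
      using wS deg_1_irreducible
      by (auto simp: extremal_gens_def min_gens_eq_irreducibles face_dim_multiples)
  qed
  then show ?thesis using W by (intro that[of W]) (auto simp: V_def)
qed

text \<open>
  If a generator \<open>g\<close> occurs often enough in \<open>s\<close>, then the multiple of \<open>g\<close> that lies in \<open>\<nat>W\<close> splits off
  from \<open>s\<close>. An element in which no generator occurs that often has bounded degree.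
\<close>

lemma cone_generators_divide_large:
  assumes W: "W \<subseteq> S" and gen: "\<And>s. s \<in> S \<Longrightarrow> \<exists>n>0. n *s s \<in> submonoid_gen W"
  obtains D where "\<And>s. s \<in> S \<Longrightarrow> D \<le> deg s \<Longrightarrow> \<exists>w\<in>W. \<exists>s'\<in>S. s = w + s'"
proof -
  obtain G where G: "finite G" "0 \<notin> G" "G \<subseteq> S" "S = submonoid_gen G"
    by (rule finite_gens)
  have "\<exists>n. \<forall>g\<in>G. n g *s g \<in> submonoid_gen W \<and> n g > 0"
    using gen G(3) by (intro bchoice) blast
  then obtain n where n: "\<And>g. g \<in> G \<Longrightarrow> n g *s g \<in> submonoid_gen W" "\<And>g. g \<in> G \<Longrightarrow> n g > 0"
    by blast
  show ?thesis
  proof (rule that[of "Suc (\<Sum>g\<in>G. n g * deg g)"])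
    fix s assume s: "s \<in> S" "Suc (\<Sum>g\<in>G. n g * deg g) \<le> deg s"
    obtain c where c: "s = (\<Sum>g\<in>G. c g *s g)"
      using submonoid_gen_finite_repr s(1) G by metis
    have "\<exists>g\<in>G. n g \<le> c g"
    proof (rule ccontr)
      assume "\<not> ?thesis"
      then have "(\<Sum>g\<in>G. c g * deg g) \<le> (\<Sum>g\<in>G. n g * deg g)"
        by (intro sum_mono) (auto simp: not_le intro: less_imp_le)
      then show False using s(2) deg_combination[OF G(3)] c by simp
    qed
    then obtain g where g: "g \<in> G" "n g \<le> c g" by blast
    have s_eq: "s = n g *s g + ((c g - n g) *s g + (\<Sum>h\<in>G - {g}. c h *s h))"
      unfolding c using g G(1)
      by (subst sum.remove[of _ g]) (auto simp flip: add.assoc vector_sadd_rdistrib)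
    have "n g *s g \<noteq> 0"
    proof -
      have "deg (n g *s g) > 0" using g(1) n(2) G deg_smult deg_pos by (metis nat_0_less_mult_iff subsetD)
      then show ?thesis using deg_0 by auto
    qed
    with n(1)[OF g(1)] obtain w x where w: "w \<in> W" "x \<in> submonoid_gen W" "n g *s g = w + x"
      by (auto elim: submonoid_gen.cases)
    have "s = w + (x + ((c g - n g) *s g + (\<Sum>h\<in>G - {g}. c h *s h)))"
      by (subst s_eq) (simp add: w(3) add.assoc)
    moreover have "x + ((c g - n g) *s g + (\<Sum>h\<in>G - {g}. c h *s h)) \<in> S"
      using w(2) submonoid_gen_subset[OF W] g(1) G(3)
      by (intro add_mem sum_mem smult_mem) auto
    ultimately show "\<exists>w\<in>W. \<exists>s'\<in>S. s = w + s'" using w(1) by blast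
  qed
qed

end

section \<open>Supports of elements of the semigroup ring\<close>

lemma poly_mapping_sum_terms:
  "p = (\<Sum>a\<in>Poly_Mapping.keys p. Poly_Mapping.single a (Poly_Mapping.lookup p a))"
  by (rule poly_mapping_eqI)
     (auto simp: Poly_Mapping.lookup_sum Poly_Mapping.lookup_single when_def in_keys_iff sum.delta)

lemma keys_sum_subset: "Poly_Mapping.keys (sum f J) \<subseteq> (\<Union>j\<in>J. Poly_Mapping.keys (f j))"
  by (induction J rule: infinite_finite_induct) (use Poly_Mapping.keys_add in \<open>fastforce+\<close>)

lemma keys_uminus: "Poly_Mapping.keys (- p) = Poly_Mapping.keys (p :: 'a \<Rightarrow>\<^sub>0 'b::ab_group_add)"
  by (auto simp: in_keys_iff)

lemma keys_xpow [simp]: "Poly_Mapping.keys (xpow a :: nat^'d \<Rightarrow>\<^sub>0 'k::field) = {a}"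
  by (simp add: xpow_def)

lemma xpow_mult: "xpow a * xpow b = (xpow (a + b) :: nat^'d \<Rightarrow>\<^sub>0 'k::field)"
  by (simp add: xpow_def mult_single)

lemma single_eq_scalar_mult_xpow: "Poly_Mapping.single a c = Poly_Mapping.single 0 c * xpow a"
  by (simp add: xpow_def mult_single)

lemma lookup_xpow_mult: "Poly_Mapping.lookup (xpow a * p) (a + b) = Poly_Mapping.lookup (p :: nat^'d \<Rightarrow>\<^sub>0 'k::field) b"
proof -
  have "xpow a * p = (\<Sum>c\<in>Poly_Mapping.keys p. Poly_Mapping.single (a + c) (Poly_Mapping.lookup p c))"
    by (subst poly_mapping_sum_terms[of p]) (simp add: sum_distrib_left xpow_def mult_single)
  then show ?thesis
    by (auto simp: Poly_Mapping.lookup_sum Poly_Mapping.lookup_single when_def in_keys_iff sum.delta)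
qed

lemma keys_xpow_mult: "Poly_Mapping.keys (xpow a * p) \<subseteq> (+) a ` Poly_Mapping.keys (p :: nat^'d \<Rightarrow>\<^sub>0 'k::field)"
  using Poly_Mapping.keys_mult[of "xpow a" p] by auto

lemma xpow_mult_cancel:
  assumes "xpow a * p = xpow a * (q :: nat^'d \<Rightarrow>\<^sub>0 'k::field)"
  shows "p = q"
  by (rule poly_mapping_eqI) (metis assms lookup_xpow_mult)

lemma xpow_dvd:
  fixes p :: "nat^'d \<Rightarrow>\<^sub>0 'k::field"
  assumes "\<And>c. c \<in> Poly_Mapping.keys p \<Longrightarrow> \<exists>s\<in>S. c = m + s"
  obtains q where "Poly_Mapping.keys q \<subseteq> S" "p = xpow m * q"
proof -
  obtain g where g: "\<And>c. c \<in> Poly_Mapping.keys p \<Longrightarrow> g c \<in> S \<and> c = m + g c"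
    using assms by metis
  define q where "q = (\<Sum>c\<in>Poly_Mapping.keys p. Poly_Mapping.single (g c) (Poly_Mapping.lookup p c))"
  have "Poly_Mapping.keys q \<subseteq> S"
    unfolding q_def using g by (intro order.trans[OF keys_sum_subset]) auto
  moreover have "xpow m * q = (\<Sum>c\<in>Poly_Mapping.keys p. Poly_Mapping.single (m + g c) (Poly_Mapping.lookup p c))"
    unfolding q_def by (simp add: sum_distrib_left xpow_def mult_single)
  then have "xpow m * q = p"
    using g poly_mapping_sum_terms[of p] by (metis (no_types, lifting) sum.cong)
  ultimately show ?thesis using that by blast
qed

lemma single_in_scalars: "Poly_Mapping.single 0 c \<in> scalars"
  unfolding scalars_def by (rule rangeI)

lemma scalarsE:
  assumes "x \<in> scalars"
  obtains c where "x = Poly_Mapping.single 0 c"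
  using assms by (auto simp: scalars_def)

section \<open>Semistandard graded semigroup rings\<close>

text \<open>
  The ring structure of \<open>R\<close> is that of the polynomial ring, so after rewriting the ring operations of
  the record by those of the type, computations take place in the polynomial ring, and only membership
  in the carrier has to be tracked.
\<close>

locale semistandard_semigroup_ring =
  fixes S :: "(nat^'d) set"
    and R :: "(nat^'d \<Rightarrow>\<^sub>0 'k::field) ring"
    and Rg :: "nat \<Rightarrow> (nat^'d \<Rightarrow>\<^sub>0 'k) set"
  assumes affine: "affine_semigroup S"
    and R_eq: "R = semigroup_ring S"
    and semistandard: "semistandard_graded R scalars Rg"
    and monomials_homogeneous: "\<forall>a\<in>S. \<exists>i. xpow a \<in> Rg i"
begin

sublocale cring R
  using semistandard by (simp add: semistandard_graded_def)

lemma ring_ops [simp]: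
  "x \<otimes>\<^bsub>R\<^esub> y = x * y" "x \<oplus>\<^bsub>R\<^esub> y = x + y" "\<one>\<^bsub>R\<^esub> = 1" "\<zero>\<^bsub>R\<^esub> = 0"
  by (simp_all add: R_eq semigroup_ring_def)

lemma carrier_iff: "p \<in> carrier R \<longleftrightarrow> Poly_Mapping.keys p \<subseteq> S"
  by (simp add: R_eq semigroup_ring_def)

lemma neg_eq [simp]: "x \<in> carrier R \<Longrightarrow> \<ominus>\<^bsub>R\<^esub> x = - x"
  using minus_equality[of "- x" x] by (simp add: carrier_iff keys_uminus)

lemma finsum_eq_sum:
  assumes "finite J" "f \<in> J \<rightarrow> carrier R"
  shows "finsum R f J = sum f J"
  using assms by (induction J) (auto simp: Pi_iff)

lemma mult_carrier: "p \<in> carrier R \<Longrightarrow> q \<in> carrier R \<Longrightarrow> p * q \<in> carrier R"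
  using m_closed by simp

lemma diff_carrier: "p \<in> carrier R \<Longrightarrow> q \<in> carrier R \<Longrightarrow> p - q \<in> carrier R"
  using a_closed[of p "\<ominus>\<^bsub>R\<^esub> q"] a_inv_closed by simp

lemma power_carrier: "p \<in> carrier R \<Longrightarrow> p ^ n \<in> carrier R"
  by (induction n) (use one_closed mult_carrier in auto)

lemma xpow_carrier: "xpow a \<in> carrier R \<longleftrightarrow> a \<in> S"
  by (simp add: carrier_iff)

subsection \<open>The degree function\<close>

lemma grading: "nat_grading R Rg" and Rg_0: "Rg 0 = scalars"
  using semistandard by (simp_all add: semistandard_graded_def)

lemma Rg_subgroup: "additive_subgroup (Rg i) R"
  using grading by (simp add: nat_grading_def)

lemma Rg_carrier: "Rg i \<subseteq> carrier R"
  using Rg_subgroup by (rule additive_subgroup.a_subset)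

lemma Rg_zero: "0 \<in> Rg i"
  using additive_subgroup.zero_closed[OF Rg_subgroup] by simp

lemma Rg_add: "x \<in> Rg i \<Longrightarrow> y \<in> Rg i \<Longrightarrow> x + y \<in> Rg i"
  using additive_subgroup.a_closed[OF Rg_subgroup, of x i y] by simp

lemma Rg_sum: "(\<And>j. j \<in> J \<Longrightarrow> f j \<in> Rg i) \<Longrightarrow> sum f J \<in> Rg i"
  by (induction J rule: infinite_finite_induct) (auto intro: Rg_zero Rg_add)

lemma Rg_mult: "x \<in> Rg i \<Longrightarrow> y \<in> Rg j \<Longrightarrow> x * y \<in> Rg (i + j)"
  using grading unfolding nat_grading_def by (metis ring_ops(1))

lemma Rg_single: "xpow a \<in> Rg i \<Longrightarrow> Poly_Mapping.single a c \<in> Rg i"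
  using Rg_mult[of "Poly_Mapping.single 0 c" 0 "xpow a" i]
  by (subst single_eq_scalar_mult_xpow) (simp add: Rg_0 single_in_scalars)

lemma homogeneous_decomposition_unique:
  assumes "\<And>i. f i \<in> Rg i" "finite {i. f i \<noteq> 0}" "\<And>i. g i \<in> Rg i" "finite {i. g i \<noteq> 0}"
    and "(\<Sum>i | f i \<noteq> 0. f i) = (\<Sum>i | g i \<noteq> 0. g i)"
  shows "f = g"
proof -
  let ?x = "\<Sum>i | f i \<noteq> 0. f i"
  have fin: "finsum R h {i. h i \<noteq> 0} = (\<Sum>i | h i \<noteq> 0. h i)"
    if "\<And>i. h i \<in> Rg i" "finite {i. h i \<noteq> 0}" for h
    using that Rg_carrier by (intro finsum_eq_sum) blast+
  have "finsum R f {i. f i \<noteq> 0} \<in> carrier R"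
    using assms(1) Rg_carrier by (intro finsum_closed) blast
  then have "?x \<in> carrier R" using fin[of f] assms(1,2) by simp
  then have "\<exists>!f. (\<forall>i. f i \<in> Rg i) \<and> finite {i. f i \<noteq> 0} \<and> ?x = finsum R f {i. f i \<noteq> 0}"
    using grading by (simp add: nat_grading_def)
  moreover have "(\<forall>i. f i \<in> Rg i) \<and> finite {i. f i \<noteq> 0} \<and> ?x = finsum R f {i. f i \<noteq> 0}"
    using fin[of f] assms by simp
  moreover have "(\<forall>i. g i \<in> Rg i) \<and> finite {i. g i \<noteq> 0} \<and> ?x = finsum R g {i. g i \<noteq> 0}"
    using fin[of g] assms by simp
  ultimately show ?thesis by blast
qed

text \<open>
  The family \<open>f\<close> and the family concentrated in degree \<open>i\<close> are both homogeneous decompositions of \<open>p\<close>.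
\<close>

lemma homogeneous_component_unique:
  assumes p: "p \<in> Rg i" and f: "\<And>i. f i \<in> Rg i" "finite {i. f i \<noteq> 0}" "p = (\<Sum>i | f i \<noteq> 0. f i)"
  shows "f = (\<lambda>j. if j = i then p else 0)"
proof (rule homogeneous_decomposition_unique)
  let ?g = "\<lambda>j. if j = i then p else 0"
  have supp: "{j. ?g j \<noteq> 0} = (if p = 0 then {} else {i})" by auto
  show "finite {j. ?g j \<noteq> 0}" unfolding supp by simp
  show "(\<Sum>i | f i \<noteq> 0. f i) = (\<Sum>j | ?g j \<noteq> 0. ?g j)"
    unfolding supp f(3)[symmetric] by simp
qed (use p f Rg_zero in auto)

definition deg :: "nat^'d \<Rightarrow> nat" where
  "deg a = (SOME i. (xpow a :: nat^'d \<Rightarrow>\<^sub>0 'k) \<in> Rg i)"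

lemma xpow_Rg: "a \<in> S \<Longrightarrow> xpow a \<in> Rg (deg a)"
  unfolding deg_def using monomials_homogeneous by (metis someI_ex)

text \<open>
  Grouping the terms of \<open>p\<close> by degree is a homogeneous decomposition of \<open>p\<close>. If \<open>p\<close> is homogeneous,
  uniqueness leaves only one group. So the abstract grading is determined by \<open>deg\<close>.
\<close>

lemma Rg_iff: "p \<in> Rg i \<longleftrightarrow> Poly_Mapping.keys p \<subseteq> {a \<in> S. deg a = i}"
proof
  assume keys: "Poly_Mapping.keys p \<subseteq> {a \<in> S. deg a = i}"
  have "(\<Sum>a\<in>Poly_Mapping.keys p. Poly_Mapping.single a (Poly_Mapping.lookup p a)) \<in> Rg i"
    using keys by (intro Rg_sum Rg_single) (use xpow_Rg in auto)
  then show "p \<in> Rg i" by (simp flip: poly_mapping_sum_terms)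
next
  assume p: "p \<in> Rg i"
  then have pS: "Poly_Mapping.keys p \<subseteq> S" using Rg_carrier carrier_iff by blast
  define comp where
    "comp j = (\<Sum>a | a \<in> Poly_Mapping.keys p \<and> deg a = j. Poly_Mapping.single a (Poly_Mapping.lookup p a))" for j
  have comp_keys: "Poly_Mapping.keys (comp j) \<subseteq> {a. deg a = j}" for j
    unfolding comp_def by (rule order.trans[OF keys_sum_subset]) auto
  have comp_Rg: "comp j \<in> Rg j" for j
    unfolding comp_def by (intro Rg_sum Rg_single) (use xpow_Rg pS in auto)
  have supp: "{j. comp j \<noteq> 0} \<subseteq> deg ` Poly_Mapping.keys p"
  proof (rule subsetI, rule ccontr)
    fix j assume "j \<in> {j. comp j \<noteq> 0}" "j \<notin> deg ` Poly_Mapping.keys p"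
    moreover from this(2) have "{a. a \<in> Poly_Mapping.keys p \<and> deg a = j} = {}" by auto
    ultimately show False unfolding comp_def by (metis (mono_tags) mem_Collect_eq sum.empty)
  qed
  then have fin: "finite {j. comp j \<noteq> 0}" by (rule finite_subset) simp
  have "p = (\<Sum>j\<in>deg ` Poly_Mapping.keys p. comp j)"
    unfolding comp_def
    by (subst (1) poly_mapping_sum_terms[of p], subst sum.image_gen[of _ _ deg]) auto
  also have "\<dots> = (\<Sum>j | comp j \<noteq> 0. comp j)"
    using supp by (intro sum.mono_neutral_right) auto
  finally have "comp = (\<lambda>j. if j = i then p else 0)"
    using homogeneous_component_unique[OF p comp_Rg fin] by blast
  then have "comp i = p" by simp
  then show "Poly_Mapping.keys p \<subseteq> {a \<in> S. deg a = i}" using comp_keys[of i] pS by auto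
qed

sublocale graded_affine_semigroup S deg
proof
  show "affine_semigroup S" by (rule affine)
next
  fix a b assume "a \<in> S" "b \<in> S"
  then have "(xpow (a + b) :: nat^'d \<Rightarrow>\<^sub>0 'k) \<in> Rg (deg a + deg b)"
    using Rg_mult[OF xpow_Rg xpow_Rg] by (simp add: xpow_mult)
  then show "deg (a + b) = deg a + deg b" by (simp add: Rg_iff)
next
  fix a assume a: "a \<in> S" "a \<noteq> 0"
  have False if "deg a = 0"
  proof -
    have "(xpow a :: nat^'d \<Rightarrow>\<^sub>0 'k) \<in> scalars" using xpow_Rg[OF a(1)] that by (simp add: Rg_0)
    then obtain c where "xpow a = (Poly_Mapping.single 0 c :: nat^'d \<Rightarrow>\<^sub>0 'k)" by (rule scalarsE)
    then have "{a} \<subseteq> {0}" by (metis keys_single keys_xpow empty_subsetI order_refl)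
    with a(2) show False by simp
  qed
  then show "deg a > 0" by blast
qed

subsection \<open>Finiteness over the subring generated in degree 1\<close>

text \<open>
  The elements of \<open>k[R\<^sub>1]\<close> have exponents that are sums of exponents of degree \<open>1\<close>; the constants
  contribute the empty sum.
\<close>

lemma keys_generate_ring:
  assumes "p \<in> generate_ring R (scalars \<union> Rg 1)"
  shows "Poly_Mapping.keys p \<subseteq> submonoid_gen {a \<in> S. deg a = 1}"
proof -
  let ?V = "{a \<in> S. deg a = 1}"
  have VS: "submonoid_gen ?V \<subseteq> S" by (rule submonoid_gen_subset) auto
  show ?thesis
    using assms
  proof induction
    case one
    show ?case by (auto intro: submonoid_gen.zero)
  next
    case (incl h)
    then show ?case by (auto simp: Rg_iff intro: submonoid_gen.zero submonoid_gen_incl elim!: scalarsE split: if_splits)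
  next
    case (a_inv h)
    then show ?case using VS by (subst neg_eq) (auto simp: carrier_iff keys_uminus)
  next
    case (eng_add g h)
    then show ?case using Poly_Mapping.keys_add[of g h] by auto
  next
    case (eng_mult g h)
    then show ?case using Poly_Mapping.keys_mult[of g h] unfolding ring_ops by (blast intro: submonoid_gen_add_closed)
  qed
qed

text \<open>
  On the level of exponents, finite generation over \<open>k[R\<^sub>1]\<close> says that \<open>S = M + K\<close>, where \<open>M\<close> is the
  submonoid generated in degree \<open>1\<close> and \<open>K\<close> is finite. Adding \<open>s\<close> to an element of \<open>K\<close> therefore
  moves it to another element of \<open>K\<close> up to \<open>M\<close>. Repeating this returns to an earlier element of \<open>K\<close>,
  and cancelling it leaves a multiple of \<open>s\<close> in \<open>M\<close>.
\<close>

lemma multiple_in_degree_1_submonoid: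
  assumes s: "s \<in> S"
  shows "\<exists>n>0. n *s s \<in> submonoid_gen {a \<in> S. deg a = 1}"
proof -
  let ?M = "submonoid_gen {a \<in> S. deg a = 1}"
  let ?A = "generate_ring R (scalars \<union> Rg 1)"
  obtain B where B: "B \<subseteq> carrier R" "finite B"
    and gen: "\<And>x. x \<in> carrier R \<Longrightarrow> \<exists>c\<in>B \<rightarrow> ?A. x = finsum R (\<lambda>b. c b * b) B"
    using semistandard unfolding semistandard_graded_def fin_gen_over_def by auto
  define K where "K = (\<Union>b\<in>B. Poly_Mapping.keys b)"
  have K: "finite K" "K \<subseteq> S" using B unfolding K_def using carrier_iff by (simp, blast)
  have MS: "?M \<subseteq> S" by (rule submonoid_gen_subset) auto
  have decomp: "\<exists>v\<in>?M. \<exists>\<beta>\<in>K. t = v + \<beta>" if t: "t \<in> S" for t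
  proof -
    obtain c where c: "c \<in> B \<rightarrow> ?A" "xpow t = finsum R (\<lambda>b. c b * b) B"
      using gen[of "xpow t"] t by (auto simp: xpow_carrier)
    have "c b \<in> carrier R" if "b \<in> B" for b
      using keys_generate_ring[of "c b"] c(1) that MS by (auto simp: carrier_iff)
    then have "finsum R (\<lambda>b. c b * b) B = (\<Sum>b\<in>B. c b * b)"
      using B by (intro finsum_eq_sum) (auto intro: mult_carrier)
    with c(2) have "Poly_Mapping.keys (xpow t :: nat^'d \<Rightarrow>\<^sub>0 'k) \<subseteq> (\<Union>b\<in>B. Poly_Mapping.keys (c b * b))"
      by (metis keys_sum_subset)
    then obtain b where b: "b \<in> B" "t \<in> Poly_Mapping.keys (c b * b)" by auto
    then obtain v \<beta> where "v \<in> Poly_Mapping.keys (c b)" "\<beta> \<in> Poly_Mapping.keys b" "t = v + \<beta>"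
      using Poly_Mapping.keys_mult[of "c b" b] by blast
    then show ?thesis using keys_generate_ring[of "c b"] c(1) b(1) by (auto simp: K_def)
  qed
  have "\<exists>f. \<forall>\<beta>\<in>K. f \<beta> \<in> K \<and> (\<exists>v\<in>?M. s + \<beta> = v + f \<beta>)"
  proof (intro bchoice ballI)
    fix \<beta> assume "\<beta> \<in> K"
    then have "s + \<beta> \<in> S" using K s add_mem by blast
    then show "\<exists>\<beta>'. \<beta>' \<in> K \<and> (\<exists>v\<in>?M. s + \<beta> = v + \<beta>')" using decomp by blast
  qed
  then obtain f where f: "\<And>\<beta>. \<beta> \<in> K \<Longrightarrow> f \<beta> \<in> K" "\<And>\<beta>. \<beta> \<in> K \<Longrightarrow> \<exists>v\<in>?M. s + \<beta> = v + f \<beta>"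
    by blast
  obtain \<beta>0 where \<beta>0: "\<beta>0 \<in> K" using decomp[OF zero_mem] by blast
  define seq where "seq i = (f ^^ i) \<beta>0" for i :: nat
  have seq_K: "seq i \<in> K" for i by (induction i) (auto simp: seq_def \<beta>0 f)
  have walk: "\<exists>v\<in>?M. j *s s + seq i = v + seq (i + j)" for i j
  proof (induction j)
    case 0
    show ?case by (intro bexI[of _ 0]) (auto intro: submonoid_gen.zero)
  next
    case (Suc j)
    then obtain v where v: "v \<in> ?M" "j *s s + seq i = v + seq (i + j)" by blast
    obtain v' where v': "v' \<in> ?M" "s + seq (i + j) = v' + seq (i + Suc j)"
      using f(2)[OF seq_K, of "i + j"] by (auto simp: seq_def)
    have "Suc j *s s + seq i = s + (j *s s + seq i)"
      by (simp add: Suc_smult_vec add.assoc)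
    also have "\<dots> = v + (s + seq (i + j))"
      by (simp only: v(2)) (rule add.left_commute)
    also have "\<dots> = (v + v') + seq (i + Suc j)"
      by (simp only: v'(2) add.assoc)
    finally show ?case using submonoid_gen_add_closed[OF v(1) v'(1)] by blast
  qed
  have "\<not> inj seq"
    using K(1) seq_K finite_subset[of "range seq" K] finite_imageD[of seq UNIV] by auto
  then obtain i i' where "seq i = seq i'" "i < i'"
    unfolding inj_def by (metis linorder_neqE_nat)
  moreover obtain v where "v \<in> ?M" "(i' - i) *s s + seq i = v + seq (i + (i' - i))"
    using walk by blast
  ultimately show ?thesis by (intro exI[of _ "i' - i"]) auto
qed

lemma extremal_generators:
  obtains W D where "W \<subseteq> extremal_gens S" "W \<subseteq> {a \<in> S. deg a = 1}"
    "\<And>s. s \<in> S \<Longrightarrow> D \<le> deg s \<Longrightarrow> \<exists>w\<in>W. \<exists>s'\<in>S. s = w + s'"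
proof -
  obtain W where W: "W \<subseteq> extremal_gens S" "W \<subseteq> {a \<in> S. deg a = 1}"
    "\<And>s. s \<in> S \<Longrightarrow> \<exists>n>0. n *s s \<in> submonoid_gen W"
    by (rule extremal_cone_generators[OF multiple_in_degree_1_submonoid]) (assumption, rule that)
  from W(2) have "W \<subseteq> S" by auto
  then obtain D where "\<And>s. s \<in> S \<Longrightarrow> D \<le> deg s \<Longrightarrow> \<exists>w\<in>W. \<exists>s'\<in>S. s = w + s'"
    by (rule cone_generators_divide_large[OF _ W(3)]) (assumption, rule that)
  then show ?thesis by (rule that[OF W(1,2)])
qed

end

context semistandard_semigroup_ring
begin

section \<open>Monomial ideals\<close>

lemma ideal_supported_in:
  assumes T: "T \<subseteq> S" "\<And>t s. t \<in> T \<Longrightarrow> s \<in> S \<Longrightarrow> t + s \<in> T"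
  shows "ideal {p. Poly_Mapping.keys p \<subseteq> T} R"
proof (rule idealI[OF ring_axioms])
  let ?I = "{p :: nat^'d \<Rightarrow>\<^sub>0 'k. Poly_Mapping.keys p \<subseteq> T}"
  have sub: "?I \<subseteq> carrier R" using T(1) by (auto simp: carrier_iff)
  show "subgroup ?I (add_monoid R)"
  proof (rule add.subgroupI)
    show "?I \<subseteq> carrier R" by (rule sub)
    show "?I \<noteq> {}" by (auto intro: exI[of _ 0])
    fix p assume "p \<in> ?I"
    then show "\<ominus>\<^bsub>R\<^esub> p \<in> ?I" using sub by (subst neg_eq) (auto simp: keys_uminus)
    fix q assume "q \<in> ?I"
    with \<open>p \<in> ?I\<close> show "p \<oplus>\<^bsub>R\<^esub> q \<in> ?I" using Poly_Mapping.keys_add[of p q] by auto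
  qed
  fix p x assume "p \<in> ?I" "x \<in> carrier R"
  then have "Poly_Mapping.keys (p * x) \<subseteq> T"
    using Poly_Mapping.keys_mult[of p x] T(2) unfolding carrier_iff by blast
  then show "p \<otimes>\<^bsub>R\<^esub> x \<in> ?I" "x \<otimes>\<^bsub>R\<^esub> p \<in> ?I" by (simp_all add: mult.commute)
qed

lemma Idl_xpow:
  assumes A: "A \<subseteq> S"
  shows "Idl\<^bsub>R\<^esub> (xpow ` A) = {p. Poly_Mapping.keys p \<subseteq> {a + s | a s. a \<in> A \<and> s \<in> S}}"
proof
  have sub: "xpow ` A \<subseteq> carrier R" using A by (auto simp: xpow_carrier)
  have "ideal {p. Poly_Mapping.keys p \<subseteq> {a + s | a s. a \<in> A \<and> s \<in> S}} R"
  proof (rule ideal_supported_in)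
    show "{a + s | a s. a \<in> A \<and> s \<in> S} \<subseteq> S" using A add_mem by auto
    fix t s assume "t \<in> {a + s | a s. a \<in> A \<and> s \<in> S}" "s \<in> S"
    then show "t + s \<in> {a + s | a s. a \<in> A \<and> s \<in> S}" using add.assoc add_mem by blast
  qed
  moreover have "xpow a \<in> {p. Poly_Mapping.keys p \<subseteq> {a + s | a s. a \<in> A \<and> s \<in> S}}" if "a \<in> A" for a
  proof -
    have "a = a + 0 \<and> a \<in> A \<and> 0 \<in> S" using that zero_mem by simp
    then show ?thesis unfolding keys_xpow mem_Collect_eq by blast
  qed
  ultimately show "Idl\<^bsub>R\<^esub> (xpow ` A) \<subseteq> {p. Poly_Mapping.keys p \<subseteq> {a + s | a s. a \<in> A \<and> s \<in> S}}"
    by (intro genideal_minimal) auto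
  show "{p. Poly_Mapping.keys p \<subseteq> {a + s | a s. a \<in> A \<and> s \<in> S}} \<subseteq> Idl\<^bsub>R\<^esub> (xpow ` A)"
  proof
    fix p :: "nat^'d \<Rightarrow>\<^sub>0 'k"
    assume p: "p \<in> {p. Poly_Mapping.keys p \<subseteq> {a + s | a s. a \<in> A \<and> s \<in> S}}"
    interpret J: ideal "Idl\<^bsub>R\<^esub> (xpow ` A)" R by (rule genideal_ideal[OF sub])
    have single_closed: "Poly_Mapping.single c x \<in> Idl\<^bsub>R\<^esub> (xpow ` A)" if c: "c \<in> Poly_Mapping.keys p" for c x
    proof -
      obtain a s where as: "a \<in> A" "s \<in> S" "c = a + s" using p c by auto
      have "xpow a \<otimes>\<^bsub>R\<^esub> Poly_Mapping.single s x \<in> Idl\<^bsub>R\<^esub> (xpow ` A)"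
        using as genideal_self[OF sub] by (intro J.I_r_closed) (auto simp: carrier_iff)
      then show ?thesis by (simp add: as(3) xpow_def mult_single)
    qed
    have sum_closed: "sum f J \<in> Idl\<^bsub>R\<^esub> (xpow ` A)"
      if "\<And>c. c \<in> J \<Longrightarrow> f c \<in> Idl\<^bsub>R\<^esub> (xpow ` A)" for f :: "nat^'d \<Rightarrow> nat^'d \<Rightarrow>\<^sub>0 'k" and J
      using that J.zero_closed J.a_closed by (induction J rule: infinite_finite_induct) auto
    have "(\<Sum>c\<in>Poly_Mapping.keys p. Poly_Mapping.single c (Poly_Mapping.lookup p c))
        \<in> Idl\<^bsub>R\<^esub> (xpow ` A)"
      by (intro sum_closed single_closed)
    then show "p \<in> Idl\<^bsub>R\<^esub> (xpow ` A)" by (simp flip: poly_mapping_sum_terms)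
  qed
qed

lemma Idl_empty: "Idl\<^bsub>R\<^esub> {} = {0}"
  using Idl_xpow[of "{}"] by simp

lemma Idl_singleton: "u \<in> carrier R \<Longrightarrow> Idl\<^bsub>R\<^esub> {u} = {u * q | q. q \<in> carrier R}"
  by (auto simp flip: cgenideal_eq_genideal simp: cgenideal_def mult.commute)

lemma irrelevant_ideal_keys:
  assumes "p \<in> irrelevant_ideal R Rg"
  shows "Poly_Mapping.keys p \<subseteq> S - {0}"
proof -
  have "ideal {p. Poly_Mapping.keys p \<subseteq> S - {0}} R"
  proof (rule ideal_supported_in)
    fix t s assume "t \<in> S - {0}" "s \<in> S"
    then show "t + s \<in> S - {0}"
      using add_mem deg_add[of t s] deg_pos[of t] deg_0 by auto
  qed auto
  moreover have "(\<Union>i\<in>{1..}. Rg i) \<subseteq> {p. Poly_Mapping.keys p \<subseteq> S - {0}}"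
    using deg_0 by (fastforce simp: Rg_iff)
  ultimately show ?thesis
    using genideal_minimal assms unfolding irrelevant_ideal_def by blast
qed

lemma keys_power_irrelevant:
  assumes "Poly_Mapping.keys p \<subseteq> S - {0}" "c \<in> Poly_Mapping.keys (p ^ n)"
  shows "c \<in> S \<and> n \<le> deg c"
  using assms(2)
proof (induction n arbitrary: c)
  case 0
  then show ?case by (simp add: zero_mem)
next
  case (Suc n)
  then obtain a b where ab: "a \<in> Poly_Mapping.keys p" "b \<in> Poly_Mapping.keys (p ^ n)" "c = a + b"
    using Poly_Mapping.keys_mult[of p "p ^ n"] by auto
  have "a \<in> S" "deg a > 0" using ab(1) assms(1) deg_pos by auto
  moreover have "b \<in> S" "n \<le> deg b" using Suc.IH[OF ab(2)] by auto
  ultimately show ?case using ab(3) add_mem[of a b] deg_add[of a b] by auto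
qed

section \<open>The trace of a monomial ideal\<close>

lemma linear_map_sum:
  assumes add: "\<forall>x\<in>M. \<forall>y\<in>M. \<phi> (x + y) = \<phi> x + (\<phi> y :: 'b::ab_group_add)"
    and M: "0 \<in> M" "\<And>x y. x \<in> M \<Longrightarrow> y \<in> M \<Longrightarrow> x + y \<in> M"
    and f: "\<And>j. j \<in> J \<Longrightarrow> f j \<in> M"
  shows "\<phi> (sum f J) = (\<Sum>j\<in>J. \<phi> (f j))"
proof -
  have "\<phi> (0 + 0) = \<phi> 0 + \<phi> 0" using add M(1) by blast
  then have \<phi>0: "\<phi> 0 = 0" by simp
  have "sum f J \<in> M \<and> \<phi> (sum f J) = (\<Sum>j\<in>J. \<phi> (f j))"
    using f by (induction J rule: infinite_finite_induct) (auto simp: \<phi>0 M add)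
  then show ?thesis by blast
qed

text \<open>
  The monomial \<open>x\<^sup>e\<close> must occur in \<open>\<phi>(f)\<close> for some \<open>\<phi>\<close> and some \<open>f\<close> in the ideal, hence in \<open>\<phi>(x\<^sup>a)\<close>
  for some monomial \<open>x\<^sup>a\<close> of \<open>f\<close>. The witness \<open>a\<close> does not depend on \<open>a'\<close>: in effect, the part of
  \<open>\<phi>\<close> of multidegree \<open>e - a\<close> is multiplication by a nonzero scalar multiple of the Laurent monomial of exponent
  \<open>e - a\<close>, and it maps every monomial of the ideal into \<open>R\<close>.
\<close>

lemma monomial_in_trace:
  assumes T: "T \<subseteq> S" "\<And>t s. t \<in> T \<Longrightarrow> s \<in> S \<Longrightarrow> t + s \<in> T"
    and e: "xpow e \<in> trace_ideal R Rg {p. Poly_Mapping.keys p \<subseteq> T}"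
  obtains a where "a \<in> T" "\<And>a'. a' \<in> T \<Longrightarrow> \<exists>s\<in>S. a' + e = a + s"
proof -
  let ?I = "{p :: nat^'d \<Rightarrow>\<^sub>0 'k. Poly_Mapping.keys p \<subseteq> T}"
  obtain \<Phi> y where \<Phi>: "finite \<Phi>" "\<Phi> \<subseteq> graded_homs R Rg (ideal_module R ?I) (\<lambda>i. ?I \<inter> int_graded R Rg i)"
    and y: "\<forall>\<phi>\<in>\<Phi>. y \<phi> \<in> \<phi> ` ?I" and ey: "xpow e = finsum R y \<Phi>"
    using e unfolding trace_ideal_def module_trace_def by (auto simp: ideal_module_def)
  have hom: "\<phi> \<in> ?I \<rightarrow> carrier R" "\<forall>x\<in>?I. \<forall>z\<in>?I. \<phi> (x + z) = \<phi> x + \<phi> z"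
    "\<And>r x. r \<in> carrier R \<Longrightarrow> x \<in> ?I \<Longrightarrow> \<phi> (r * x) = r * \<phi> x" if "\<phi> \<in> \<Phi>" for \<phi>
    using \<Phi>(2) that unfolding graded_homs_def ideal_module_def by auto
  have "y \<in> \<Phi> \<rightarrow> carrier R" using y hom(1) by fastforce
  then have "xpow e = sum y \<Phi>" using ey \<Phi>(1) finsum_eq_sum by simp
  then have "e \<in> Poly_Mapping.keys (sum y \<Phi>)" by (metis keys_xpow singletonI)
  then obtain \<phi> where \<phi>: "\<phi> \<in> \<Phi>" "e \<in> Poly_Mapping.keys (y \<phi>)"
    using keys_sum_subset[of y \<Phi>] by auto
  then obtain f where f: "f \<in> ?I" "y \<phi> = \<phi> f" using y by auto
  note hom = hom[OF \<phi>(1)]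
  have xpow_I: "xpow a \<in> ?I" if "a \<in> T" for a using that by simp
  have sc: "Poly_Mapping.single 0 c \<in> carrier R" for c :: 'k
    using zero_mem by (simp add: carrier_iff)
  have "\<phi> f = \<phi> (\<Sum>a\<in>Poly_Mapping.keys f. Poly_Mapping.single a (Poly_Mapping.lookup f a))"
    by (simp flip: poly_mapping_sum_terms)
  also have "\<dots> = (\<Sum>a\<in>Poly_Mapping.keys f. \<phi> (Poly_Mapping.single a (Poly_Mapping.lookup f a)))"
  proof (rule linear_map_sum[OF hom(2)])
    show "x + z \<in> ?I" if "x \<in> ?I" "z \<in> ?I" for x z
      using that Poly_Mapping.keys_add[of x z] by auto
  qed (use f(1) in auto)
  also have "\<dots> = (\<Sum>a\<in>Poly_Mapping.keys f. Poly_Mapping.single 0 (Poly_Mapping.lookup f a) * \<phi> (xpow a))"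
  proof (rule sum.cong[OF refl])
    fix a assume "a \<in> Poly_Mapping.keys f"
    then have "a \<in> T" using f(1) by auto
    then show "\<phi> (Poly_Mapping.single a (Poly_Mapping.lookup f a))
        = Poly_Mapping.single 0 (Poly_Mapping.lookup f a) * \<phi> (xpow a)"
      by (subst single_eq_scalar_mult_xpow) (rule hom(3)[OF sc xpow_I])
  qed
  finally have "e \<in> Poly_Mapping.keys
      (\<Sum>a\<in>Poly_Mapping.keys f. Poly_Mapping.single 0 (Poly_Mapping.lookup f a) * \<phi> (xpow a))"
    using \<phi>(2) f(2) by simp
  then have "e \<in> (\<Union>a\<in>Poly_Mapping.keys f.
      Poly_Mapping.keys (Poly_Mapping.single 0 (Poly_Mapping.lookup f a) * \<phi> (xpow a)))"
    by (rule subsetD[OF keys_sum_subset])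
  then obtain a c where a: "a \<in> Poly_Mapping.keys f" "e \<in> Poly_Mapping.keys (Poly_Mapping.single 0 c * \<phi> (xpow a))"
    by blast
  have e_key: "e \<in> Poly_Mapping.keys (\<phi> (xpow a))"
    using a(2) Poly_Mapping.keys_mult[of "Poly_Mapping.single 0 c" "\<phi> (xpow a)"]
    by (auto split: if_splits)
  have aT: "a \<in> T" using a(1) f(1) by auto
  show ?thesis
  proof (rule that[OF aT])
    fix a' assume a': "a' \<in> T"
    \<comment> \<open>Evaluate \<open>\<phi>\<close> at the product of the two monomials in two ways.\<close>
    have "xpow a' * \<phi> (xpow a) = \<phi> (xpow a' * xpow a)"
      using hom(3)[of "xpow a'" "xpow a"] a' aT T(1) by (auto simp: xpow_carrier)
    also have "\<dots> = xpow a * \<phi> (xpow a')"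
      using hom(3)[of "xpow a" "xpow a'"] a' aT T(1) by (auto simp: xpow_carrier mult.commute)
    finally have comm: "xpow a' * \<phi> (xpow a) = xpow a * \<phi> (xpow a')" .
    have "Poly_Mapping.lookup (xpow a' * \<phi> (xpow a)) (a' + e) \<noteq> 0"
      using e_key by (simp add: lookup_xpow_mult in_keys_iff)
    then have "a' + e \<in> Poly_Mapping.keys (xpow a * \<phi> (xpow a'))"
      unfolding comm by (simp add: in_keys_iff)
    then have "a' + e \<in> (+) a ` Poly_Mapping.keys (\<phi> (xpow a'))"
      using keys_xpow_mult by blast
    moreover have "\<phi> (xpow a') \<in> carrier R" using hom(1) xpow_I[OF a'] by blast
    ultimately show "\<exists>s\<in>S. a' + e = a + s" unfolding carrier_iff by blast
  qed
qed

section \<open>Depth at least two\<close>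

text \<open>
  A supremum of lengths that is at least two comes from some regular sequence of length at least two;
  \<open>u\<close> and \<open>v\<close> are its first two members.
\<close>

lemma depth_two_regular_pair:
  assumes "graded_depth R Rg \<ge> 2"
  obtains u v where "u \<in> carrier R" "v \<in> carrier R"
    "Poly_Mapping.keys u \<subseteq> S - {0}" "Poly_Mapping.keys v \<subseteq> S - {0}"
    "\<And>r. r \<in> carrier R \<Longrightarrow> u * r = 0 \<Longrightarrow> r = 0"
    "\<And>r q. r \<in> carrier R \<Longrightarrow> q \<in> carrier R \<Longrightarrow> v * r = u * q \<Longrightarrow> \<exists>q'\<in>carrier R. r = u * q'"
proof -
  have "\<exists>xs. set xs \<subseteq> irrelevant_ideal R Rg \<and> regular_sequence R xs \<and> 2 \<le> length xs"
  proof (rule ccontr)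
    assume neg: "\<not> ?thesis"
    have "graded_depth R Rg \<le> 1"
      unfolding graded_depth_def
    proof (rule Sup_least)
      fix z assume "z \<in> {enat (length xs) |xs. set xs \<subseteq> irrelevant_ideal R Rg \<and> regular_sequence R xs}"
      then obtain xs where z: "z = enat (length xs)"
        and xs: "set xs \<subseteq> irrelevant_ideal R Rg" "regular_sequence R xs" by auto
      then have "\<not> 2 \<le> length xs" using neg by metis
      then show "z \<le> 1" unfolding z by (simp add: one_enat_def)
    qed
    with assms have "(2::enat) \<le> 1" by (rule order_trans)
    then show False by (simp add: one_enat_def numeral_eq_enat)
  qed
  then obtain u v zs where xs: "set (u # v # zs) \<subseteq> irrelevant_ideal R Rg" "regular_sequence R (u # v # zs)"
    by (metis Suc_le_length_iff numeral_2_eq_2)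
  let ?xs = "u # v # zs"
  have uv: "u \<in> carrier R" "v \<in> carrier R"
    using xs(2) by (auto simp: regular_sequence_def)
  have reg: "(?xs ! i) * r \<in> Idl\<^bsub>R\<^esub> (set (take i ?xs)) \<Longrightarrow> r \<in> Idl\<^bsub>R\<^esub> (set (take i ?xs))"
    if "i < length ?xs" "r \<in> carrier R" for i r
    using xs(2) that unfolding regular_sequence_def by simp
  show ?thesis
  proof (rule that[OF uv])
    show "Poly_Mapping.keys u \<subseteq> S - {0}" "Poly_Mapping.keys v \<subseteq> S - {0}"
      using xs(1) irrelevant_ideal_keys by auto
    show "r = 0" if "r \<in> carrier R" "u * r = 0" for r
      using reg[of 0 r] that by (simp add: Idl_empty)
    show "\<exists>q'\<in>carrier R. r = u * q'" if "r \<in> carrier R" "q \<in> carrier R" "v * r = u * q" for r q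
      using reg[of 1 r] that by (auto simp: Idl_singleton[OF uv(1)])
  qed
qed

text \<open>
  Powers of a regular sequence of length two are again such a sequence. The exponent of \<open>u\<close> is raised
  by dividing out one factor \<open>u\<close> at a time, and afterwards the factors \<open>v\<close> are removed one by one.
\<close>

lemma regular_pair_powers:
  assumes uv: "u \<in> carrier R" "v \<in> carrier R"
    and reg_u: "\<And>r. r \<in> carrier R \<Longrightarrow> u * r = 0 \<Longrightarrow> r = 0"
    and reg_v: "\<And>r q. r \<in> carrier R \<Longrightarrow> q \<in> carrier R \<Longrightarrow> v * r = u * q \<Longrightarrow> \<exists>q'\<in>carrier R. r = u * q'"
    and r: "r \<in> carrier R" and q: "q \<in> carrier R" and eq: "v ^ n * r = u ^ m * q"
  shows "\<exists>q'\<in>carrier R. r = u ^ m * q'"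
proof -
  have reg_v_pow: "\<exists>q'\<in>carrier R. r = u ^ m * q'"
    if "r \<in> carrier R" "q \<in> carrier R" "v * r = u ^ m * q" for r q
    using that
  proof (induction m arbitrary: r q)
    case 0
    then show ?case by auto
  next
    case (Suc m)
    have "v * r = u * (u ^ m * q)" using Suc.prems(3) by (simp add: mult.assoc)
    then obtain q' where q': "q' \<in> carrier R" "r = u * q'"
      using reg_v[OF Suc.prems(1)] uv Suc.prems(2) by (meson mult_carrier power_carrier)
    have carrier: "v * q' - u ^ m * q \<in> carrier R"
      using uv q'(1) Suc.prems(2) by (intro diff_carrier mult_carrier power_carrier)
    have "u * (v * q' - u ^ m * q) = 0"
      using Suc.prems(3) by (simp add: q'(2) algebra_simps)
    then have "v * q' - u ^ m * q = 0" by (rule reg_u[OF carrier])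
    then obtain q'' where "q'' \<in> carrier R" "q' = u ^ m * q''"
      using Suc.IH[OF q'(1) Suc.prems(2)] by auto
    then show ?case using q'(2) by (intro bexI[of _ q'']) (simp_all add: mult.assoc)
  qed
  show ?thesis
    using r eq
  proof (induction n arbitrary: r)
    case 0
    then show ?case using q by auto
  next
    case (Suc n)
    have "v ^ n * (v * r) = u ^ m * q" using Suc.prems(2) by (simp add: ac_simps)
    then obtain q' where "q' \<in> carrier R" "v * r = u ^ m * q'"
      using Suc.IH uv(2) Suc.prems(1) mult_carrier by blast
    then show ?case using reg_v_pow Suc.prems(1) by blast
  qed
qed

text \<open>
  The local cohomology \<open>H\<^sup>0\<close> of \<open>R/x\<^sup>m R\<close> at the irrelevant ideal vanishes. Although \<open>u\<close> and \<open>v\<close> need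
  not be homogeneous, all exponents of their \<open>D\<close>-th powers have degree at least \<open>D\<close>, so the hypothesis
  \<open>large\<close> applies to each term.
\<close>

lemma depth_two_principal_monomial_saturated:
  assumes depth: "graded_depth R Rg \<ge> 2"
    and m: "m \<in> S" and a: "a \<in> S"
    and large: "\<And>s. s \<in> S \<Longrightarrow> D \<le> deg s \<Longrightarrow> \<exists>s'\<in>S. a + s = m + s'"
  shows "\<exists>s\<in>S. a = m + s"
proof -
  obtain u v where uv: "u \<in> carrier R" "v \<in> carrier R"
    and keys: "Poly_Mapping.keys u \<subseteq> S - {0}" "Poly_Mapping.keys v \<subseteq> S - {0}"
    and reg_u: "\<And>r. r \<in> carrier R \<Longrightarrow> u * r = 0 \<Longrightarrow> r = 0"
    and reg_v: "\<And>r q. r \<in> carrier R \<Longrightarrow> q \<in> carrier R \<Longrightarrow> v * r = u * q \<Longrightarrow> \<exists>q'\<in>carrier R. r = u * q'"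
    by (rule depth_two_regular_pair[OF depth]) (rule that)
  have dvd: "\<exists>q\<in>carrier R. xpow a * w ^ D = xpow m * q" if w: "Poly_Mapping.keys w \<subseteq> S - {0}" for w :: "nat^'d \<Rightarrow>\<^sub>0 'k"
  proof -
    have "\<exists>s'\<in>S. c = m + s'" if c: "c \<in> Poly_Mapping.keys (xpow a * w ^ D)" for c
    proof -
      obtain s where s: "s \<in> Poly_Mapping.keys (w ^ D)" "c = a + s"
        using subsetD[OF keys_xpow_mult c] by blast
      show ?thesis using large keys_power_irrelevant[OF w s(1)] unfolding s(2) by simp
    qed
    then obtain q where "Poly_Mapping.keys q \<subseteq> S" "xpow a * w ^ D = xpow m * q"
      by (rule xpow_dvd)
    then show ?thesis by (auto simp: carrier_iff)
  qed
  obtain p where p: "p \<in> carrier R" "xpow a * u ^ D = xpow m * p" using dvd keys(1) by blast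
  obtain q where q: "q \<in> carrier R" "xpow a * v ^ D = xpow m * q" using dvd keys(2) by blast
  have "xpow m * (v ^ D * p) = v ^ D * (xpow m * p)" by (simp add: ac_simps)
  also have "\<dots> = u ^ D * (xpow a * v ^ D)" unfolding p(2)[symmetric] by (simp add: ac_simps)
  also have "\<dots> = xpow m * (u ^ D * q)" unfolding q(2) by (simp add: ac_simps)
  finally have cross: "v ^ D * p = u ^ D * q" by (rule xpow_mult_cancel)
  have "\<exists>p'\<in>carrier R. p = u ^ D * p'"
    by (rule regular_pair_powers[OF uv reg_u reg_v p(1) q(1) cross])
  then obtain p' where p': "p' \<in> carrier R" "p = u ^ D * p'" by blast
  have u_pow: "r = 0" if "r \<in> carrier R" "u ^ n * r = 0" for n r
    using that
  proof (induction n arbitrary: r)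
    case (Suc n)
    have "u ^ n * (u * r) = 0" using Suc.prems(2) by (simp add: ac_simps)
    then have "u * r = 0" using Suc.IH Suc.prems(1) uv(1) mult_carrier by blast
    then show ?case using reg_u Suc.prems(1) by blast
  qed simp
  have carrier: "xpow a - xpow m * p' \<in> carrier R"
    using m a p'(1) by (intro diff_carrier mult_carrier) (simp_all add: xpow_carrier)
  have "u ^ D * (xpow a - xpow m * p') = 0"
    using p(2) unfolding p'(2) by (simp add: algebra_simps)
  then have "xpow a - xpow m * p' = 0" by (rule u_pow[OF carrier])
  then have "xpow a = xpow m * p'" by simp
  then have "a \<in> Poly_Mapping.keys (xpow m * p')" by (metis keys_xpow singletonI)
  then have "a \<in> (+) m ` Poly_Mapping.keys p'" using keys_xpow_mult by blast
  then show ?thesis using p'(1) unfolding carrier_iff by blast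
qed

section \<open>Dimension of spaces spanned by monomials\<close>

lemma dimension_supported_in:
  assumes "finite J" "J \<subseteq> S"
  shows "dimension (card J) scalars {p. Poly_Mapping.keys p \<subseteq> J}"
  using assms
proof (induction J)
  case empty
  have "{p :: nat^'d \<Rightarrow>\<^sub>0 'k. Poly_Mapping.keys p \<subseteq> {}} = {\<zero>\<^bsub>R\<^esub>}" by auto
  then show ?case using zero_dim by simp
next
  case (insert a J)
  let ?E = "{p :: nat^'d \<Rightarrow>\<^sub>0 'k. Poly_Mapping.keys p \<subseteq> J}"
  have line: "line_extension scalars (xpow a) ?E = {x * xpow a + p | x p. x \<in> scalars \<and> p \<in> ?E}"
    unfolding line_extension_def set_add_def set_mult_def r_coset_def by auto
  have "line_extension scalars (xpow a) ?E = {p. Poly_Mapping.keys p \<subseteq> insert a J}"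
    unfolding line
  proof (intro equalityI subsetI)
    fix z assume "z \<in> {x * xpow a + p | x p. x \<in> scalars \<and> p \<in> ?E}"
    then obtain c p where z: "z = Poly_Mapping.single a c + p" "p \<in> ?E"
      by (auto simp: single_eq_scalar_mult_xpow[of a] elim!: scalarsE)
    then show "z \<in> {p. Poly_Mapping.keys p \<subseteq> insert a J}"
      using Poly_Mapping.keys_add[of "Poly_Mapping.single a c" p] by (auto split: if_splits)
  next
    fix z :: "nat^'d \<Rightarrow>\<^sub>0 'k" assume z: "z \<in> {p. Poly_Mapping.keys p \<subseteq> insert a J}"
    let ?t = "Poly_Mapping.single a (Poly_Mapping.lookup z a)"
    have "Poly_Mapping.keys (z - ?t) \<subseteq> J"
      using z by (auto simp: in_keys_iff lookup_minus Poly_Mapping.lookup_single when_def split: if_splits)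
    moreover have "z = Poly_Mapping.single 0 (Poly_Mapping.lookup z a) * xpow a + (z - ?t)"
      by (simp flip: single_eq_scalar_mult_xpow)
    ultimately show "z \<in> {x * xpow a + p | x p. x \<in> scalars \<and> p \<in> ?E}"
      using single_in_scalars by blast
  qed
  moreover have "dimension (Suc (card J)) scalars (line_extension scalars (xpow a) ?E)"
    using insert by (intro Suc_dim) (auto simp: xpow_carrier)
  ultimately show ?case using insert by simp
qed

end

section \<open>Monomials of least degree\<close>

context semistandard_semigroup_ring
begin

text \<open>
  The witness \<open>a\<close> of \<open>monomial_in_trace\<close> divides \<open>m + w\<close>, which has degree \<open>deg m + 1\<close>. So either \<open>a\<close> has
  the least degree and equals \<open>m\<close>, or \<open>a = m + w\<close> and cancelling \<open>w\<close> shows even \<open>t \<in> m + S\<close>.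
\<close>

lemma trace_forces_divisibility:
  assumes T: "T \<subseteq> S" "\<And>t s. t \<in> T \<Longrightarrow> s \<in> S \<Longrightarrow> t + s \<in> T"
    and m: "m \<in> T" "\<And>t. t \<in> T \<Longrightarrow> deg m \<le> deg t" "\<And>t. t \<in> T \<Longrightarrow> deg t = deg m \<Longrightarrow> t = m"
    and w: "w \<in> S" "deg w = 1"
    and trace: "xpow w \<in> trace_ideal R Rg {p. Poly_Mapping.keys p \<subseteq> T}"
    and t: "t \<in> T"
  shows "\<exists>s\<in>S. t + w = m + s"
proof -
  obtain a where a: "a \<in> T" and div: "\<And>t. t \<in> T \<Longrightarrow> \<exists>s\<in>S. t + w = a + s"
    by (rule monomial_in_trace[OF T trace]) (assumption, assumption, rule that)
  obtain s where s: "s \<in> S" "m + w = a + s" using div[OF m(1)] by blast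
  have "deg (m + w) = deg m + 1" using m(1) w T(1) by (subst deg_add) auto
  moreover have "deg (a + s) = deg a + deg s" using a s(1) T(1) by (intro deg_add) auto
  ultimately have deg_eq: "deg m + 1 = deg a + deg s" using s(2) by simp
  show ?thesis
  proof (cases "deg a = deg m")
    case True
    then have "a = m" using m(3) a by blast
    then show ?thesis using div t by blast
  next
    case False
    then have "deg s = 0" using deg_eq m(2)[OF a] by linarith
    then have "a = m + w" using s deg_eq_0_iff by simp
    then obtain s' where s': "s' \<in> S" "t + w = (m + w) + s'" using div[OF t] by blast
    then have "t + w = (m + s') + w" by (simp only: ac_simps)
    then have "t = m + s'" by simp
    then show ?thesis using s'(1) w(1) by (intro bexI[of _ "s' + w"]) (auto simp: add.assoc intro: add_mem)
  qed
qed

text \<open>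
  If \<open>m\<close> were the only exponent of least degree, then every \<open>t \<in> T\<close> would satisfy \<open>t + s \<in> m + S\<close> for
  all \<open>s\<close> of large degree, as such an \<open>s\<close> has a summand in \<open>W\<close>. Depth at least two then gives
  \<open>t \<in> m + S\<close>, making the ideal principal.
\<close>

lemma initial_degree_two_monomials:
  assumes T: "T \<subseteq> S" "\<And>t s. t \<in> T \<Longrightarrow> s \<in> S \<Longrightarrow> t + s \<in> T"
    and nonprincipal: "\<And>m. m \<in> S \<Longrightarrow> T \<noteq> {m + s | s. s \<in> S}"
    and depth: "graded_depth R Rg \<ge> 2"
    and trace: "xpow ` extremal_gens S \<subseteq> trace_ideal R Rg {p. Poly_Mapping.keys p \<subseteq> T}"
    and m: "m \<in> T" "\<And>t. t \<in> T \<Longrightarrow> deg m \<le> deg t"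
  shows "\<exists>m'\<in>T. deg m' = deg m \<and> m' \<noteq> m"
proof (rule ccontr)
  assume "\<not> ?thesis"
  then have unique: "t = m" if "t \<in> T" "deg t = deg m" for t
    using that by blast
  obtain W D where W: "W \<subseteq> extremal_gens S" "W \<subseteq> {a \<in> S. deg a = 1}"
    and large: "\<And>s. s \<in> S \<Longrightarrow> D \<le> deg s \<Longrightarrow> \<exists>w\<in>W. \<exists>s'\<in>S. s = w + s'"
    by (rule extremal_generators) (rule that)
  have "\<exists>s\<in>S. t = m + s" if t: "t \<in> T" for t
  proof (rule depth_two_principal_monomial_saturated[OF depth])
    show "m \<in> S" "t \<in> S" using m t T(1) by auto
    fix s assume "s \<in> S" "D \<le> deg s"
    then obtain w s' where w: "w \<in> W" "s' \<in> S" "s = w + s'" using large by blast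
    then have "w \<in> S" "deg w = 1" "xpow w \<in> trace_ideal R Rg {p. Poly_Mapping.keys p \<subseteq> T}"
      using W trace by blast+
    have "\<exists>s\<in>S. t + w = m + s"
      by (rule trace_forces_divisibility[of T m w t]; fact)
    then obtain s'' where s'': "s'' \<in> S" "t + w = m + s''" by blast
    then have "t + s = m + (s'' + s')" using w(3) by (simp add: add.assoc[symmetric])
    then show "\<exists>s'\<in>S. t + s = m + s'" using add_mem[OF s''(1) w(2)] by blast
  qed
  then have "T = {m + s | s. s \<in> S}" using T(2) m(1) by blast
  then show False using nonprincipal m(1) T(1) by blast
qed

end

theorem theorem3p5:
  fixes S :: "(nat^'d) set"
    and R :: "(nat^'d \<Rightarrow>\<^sub>0 'k::field) ring"
    and Rg :: "nat \<Rightarrow> (nat^'d \<Rightarrow>\<^sub>0 'k) set"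
    and I :: "(nat^'d \<Rightarrow>\<^sub>0 'k) set"
    and b :: nat
  assumes "affine_semigroup S"
    and "R = semigroup_ring S"
    and "semistandard_graded R scalars Rg"
    and "\<forall>a\<in>S. \<exists>i. xpow a \<in> Rg i"
    and "monomial_ideal S I"
    and "\<not> principalideal I R"
    and "b = (LEAST i. I \<inter> Rg i \<noteq> {\<zero>\<^bsub>R\<^esub>})"
    and "graded_depth R Rg \<ge> 2"
    and "Idl\<^bsub>R\<^esub> (xpow ` extremal_gens S) \<subseteq> trace_ideal R Rg I"
  shows "\<exists>n\<ge>2. ring.dimension R n scalars (I \<inter> Rg b)"
proof -
  interpret semistandard_semigroup_ring S R Rg
    using assms(1-4) by unfold_locales
  obtain A where A: "A \<subseteq> S" "I = Idl\<^bsub>R\<^esub> (xpow ` A)"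
    using assms(2,5) unfolding monomial_ideal_def by auto
  define T where "T = {a + s | a s. a \<in> A \<and> s \<in> S}"
  have I_eq: "I = {p. Poly_Mapping.keys p \<subseteq> T}"
    unfolding A(2) T_def by (rule Idl_xpow[OF A(1)])
  have T: "T \<subseteq> S" "\<And>t s. t \<in> T \<Longrightarrow> s \<in> S \<Longrightarrow> t + s \<in> T"
    unfolding T_def using A(1) add_mem add.assoc by blast+
  have "ideal I R" unfolding I_eq using T by (rule ideal_supported_in)
  then have not_singly_generated: "I \<noteq> Idl\<^bsub>R\<^esub> {p}" if "p \<in> carrier R" for p
    using that assms(6) principalidealI by blast
  have nonprincipal: "T \<noteq> {m + s | s. s \<in> S}" if "m \<in> S" for m
    using not_singly_generated[of "xpow m"] Idl_xpow[of "{m}"] that by (auto simp: I_eq xpow_carrier)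
  have "T \<noteq> {}"
  proof
    assume "T = {}"
    then have "I = {0}" by (simp add: I_eq)
    then show False using not_singly_generated[of 0] genideal_zero zero_closed by simp
  qed
  define Tb where "Tb = {t \<in> T. deg t = b}"
  have I_deg: "I \<inter> Rg i = {p. Poly_Mapping.keys p \<subseteq> {t \<in> T. deg t = i}}" for i
    unfolding I_eq Int_def Rg_iff using T(1) by blast
  have "I \<inter> Rg i \<noteq> {\<zero>\<^bsub>R\<^esub>} \<longleftrightarrow> (\<exists>t\<in>T. deg t = i)" for i
  proof
    assume "\<exists>t\<in>T. deg t = i"
    then obtain t where "t \<in> T" "deg t = i" by blast
    then have "xpow t \<in> I \<inter> Rg i" by (simp add: I_deg)
    moreover have "(xpow t :: nat^'d \<Rightarrow>\<^sub>0 'k) \<noteq> 0" by (metis keys_xpow keys_zero insert_not_empty)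
    ultimately show "I \<inter> Rg i \<noteq> {\<zero>\<^bsub>R\<^esub>}" by auto
  next
    assume nonzero: "I \<inter> Rg i \<noteq> {\<zero>\<^bsub>R\<^esub>}"
    show "\<exists>t\<in>T. deg t = i"
    proof (rule ccontr)
      assume "\<not> ?thesis"
      then have "{t \<in> T. deg t = i} = {}" by blast
      with nonzero show False unfolding I_deg by simp
    qed
  qed
  then have b: "b = (LEAST i. \<exists>t\<in>T. deg t = i)" using assms(7) by simp
  have "\<exists>t\<in>T. deg t = b"
    unfolding b by (rule LeastI_ex) (use \<open>T \<noteq> {}\<close> in blast)
  then obtain m where m: "m \<in> T" "deg m = b" by blast
  have least: "deg m \<le> deg t" if "t \<in> T" for t
    unfolding m(2) unfolding b using that by (intro Least_le) blast
  have "xpow ` extremal_gens S \<subseteq> Idl\<^bsub>R\<^esub> (xpow ` extremal_gens S)"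
    by (rule genideal_self)
       (auto simp: xpow_carrier extremal_gens_def min_gens_eq_irreducibles irreducibles_def)
  then have trace: "xpow ` extremal_gens S \<subseteq> trace_ideal R Rg {p. Poly_Mapping.keys p \<subseteq> T}"
    using assms(9) unfolding I_eq by blast
  have "\<exists>m'\<in>T. deg m' = deg m \<and> m' \<noteq> m"
    by (rule initial_degree_two_monomials[OF T nonprincipal assms(8) trace m(1) least])
  then obtain m' where m': "m' \<in> T" "deg m' = deg m" "m' \<noteq> m" by blast
  have fin: "finite Tb"
    by (rule finite_subset[OF _ finite_deg_le[of b]]) (use T(1) in \<open>auto simp: Tb_def\<close>)
  have "card {m, m'} \<le> card Tb"
    using m m' by (intro card_mono[OF fin]) (auto simp: Tb_def)
  then have "2 \<le> card Tb" using m'(3) by simp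
  moreover have "dimension (card Tb) scalars (I \<inter> Rg b)"
    unfolding I_deg Tb_def[symmetric]
    by (rule dimension_supported_in[OF fin]) (use T(1) in \<open>auto simp: Tb_def\<close>)
  ultimately show ?thesis by blast
qed

end
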